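(* Let $G$ be a connected non-compact simple real Lie group with finite center such that $\Phi_{\rm red}$ is of type $A_n, B_n, C_n, D_n$ or $E_7$, and let $H_0\in\overline{\mathfrak a}_+$ be extremal. Let $M$ be the centralizer of $H_0$ in $G$. Then $\Phi_{M,\rm red}$ is a semi-dense root subsystem of $\Phi_{\rm red}$.
   Context: $\mathfrak g=\mathfrak p\oplus\mathfrak k$ is a Cartan decomposition, $\mathfrak a\subset\mathfrak p$ maximal abelian, $\Phi\subset\mathfrak a^*$ the restricted roots, $\Delta$ a base of simple roots, $\overline{\mathfrak a}_+=\{H\in\mathfrak a:\alpha(H)\ge0\ \forall\alpha\in\Delta\}$. $\Phi_{\rm red}=\{\alpha\in\Phi:\alpha/2\notin\Phi\}$ is the reduced root system (also with base $\Delta$). $\Phi_M=\{\alpha\in\Phi:\alpha(H_0)=0\}$ is the set of roots of $A=\exp\mathfrak a$ in $M$, and $\Phi_{M,\rm red}=\Phi_M\cap\Phi_{\rm red}$. Fundamental coweights $\varpi^\vee_\alpha\in\mathfrak a$, $\alpha\in\Delta$, form the dual basis to $\Delta$. An element $H_0\in\overline{\mathfrak a}_+$ is extremal if it is a positive multiple of an extremal fundamental coweight, i.e. one corresponding to the following nodes of the Dynkin diagram of $\Phi_{\rm red}$ (Bourbaki numbering): type $A_n$ ($n\ge1$): either end node $1$ or $n$; $B_n$ ($n\ge2$): node $1$; $C_n$ ($n\ge3$): node $1$; $D_n$ ($n\ge4$): node $1$; $E_7$: node $7$. (Then $\Phi_{M,\rm red}$ has type $A_{n-1},B_{n-1},C_{n-1},D_{n-1},E_6$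 respectively, with $B_1=A_1$, $C_2=B_2$, $D_3=A_3$, $A_0=\emptyset$.) For a reduced root system $\Phi'$, a root subsystem is semistandard if it is a Weyl group translate of the root subsystem generated by a subset of the simple roots (equivalently, it is the intersection of $\Phi'$ with a linear subspace). A semistandard root subsystem $\Phi_0\subset\Phi'$ is semi-dense if for every semistandard root subsystem $\Psi\subset\Phi'$, $|\Psi\cap\Phi_0|+\mathrm{rank}(\Psi)\ge\frac12|\Psi|$. *)

theory Defs
  imports
    "HOL-Analysis.Analysis"
    "HOL-Algebra.Group"
    "HOL-Library.Function_Algebras"
begin

section \<open>Smooth maps, charts and Lie groups\<close>

fun Ck_on :: "nat \<Rightarrow> ('a::real_normed_vector \<Rightarrow> 'b::real_normed_vector) \<Rightarrow> 'a set \<Rightarrow> bool" where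
  "Ck_on 0 f S \<longleftrightarrow> continuous_on S f"
| "Ck_on (Suc k) f S \<longleftrightarrow>
     (\<forall>x\<in>S. f differentiable (at x)) \<and>
     (\<forall>v. Ck_on k (\<lambda>x. frechet_derivative f (at x) v) S)"

text \<open>Only meaningful for finite-dimensional domains and open \<open>S\<close>, the only case used below.\<close>
definition smooth_on :: "('a::euclidean_space \<Rightarrow> 'b::real_normed_vector) \<Rightarrow> 'a set \<Rightarrow> bool" where
  "smooth_on f S \<longleftrightarrow> open S \<and> (\<forall>k. Ck_on k f S)"

definition is_chart :: "'g topology \<Rightarrow> 'g set \<Rightarrow> ('g \<Rightarrow> 'v::euclidean_space) \<Rightarrow> bool" where
  "is_chart T U \<phi> \<longleftrightarrow> openin T U \<and> open (\<phi> ` U) \<and>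
     homeomorphic_map (subtopology T U) (top_of_set (\<phi> ` U)) \<phi>"

definition smooth_manifold :: "'g topology \<Rightarrow> ('g set \<times> ('g \<Rightarrow> 'v::euclidean_space)) set \<Rightarrow> bool" where
  "smooth_manifold T \<A> \<longleftrightarrow>
     Hausdorff_space T \<and> second_countable T \<and>
     (\<forall>(U, \<phi>)\<in>\<A>. is_chart T U \<phi>) \<and>
     (\<Union>(U, \<phi>)\<in>\<A>. U) = topspace T \<and>
     (\<forall>(U, \<phi>)\<in>\<A>. \<forall>(V, \<psi>)\<in>\<A>. smooth_on (\<lambda>x. \<psi> (inv_into U \<phi> x)) (\<phi> ` (U \<inter> V)))"

definition lie_group ::
  "('g, 'x) monoid_scheme \<Rightarrow> 'g topology \<Rightarrow> ('g set \<times> ('g \<Rightarrow> 'v::euclidean_space)) set \<Rightarrow> bool" where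
  "lie_group G T \<A> \<longleftrightarrow>
     group G \<and> topspace T = carrier G \<and> smooth_manifold T \<A> \<and>
     continuous_map (prod_topology T T) T (\<lambda>(x, y). x \<otimes>\<^bsub>G\<^esub> y) \<and>
     continuous_map T T (\<lambda>x. inv\<^bsub>G\<^esub> x) \<and>
     (\<forall>(U, \<phi>)\<in>\<A>. \<forall>(V, \<psi>)\<in>\<A>. \<forall>(W, \<eta>)\<in>\<A>.
        smooth_on (\<lambda>(x, y). \<eta> (inv_into U \<phi> x \<otimes>\<^bsub>G\<^esub> inv_into V \<psi> y))
          {(x, y). x \<in> \<phi> ` U \<and> y \<in> \<psi> ` V \<and> inv_into U \<phi> x \<otimes>\<^bsub>G\<^esub> inv_into V \<psi> y \<in> W}) \<and>
     (\<forall>(U, \<phi>)\<in>\<A>. \<forall>(W, \<eta>)\<in>\<A>.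
        smooth_on (\<lambda>x. \<eta> (inv\<^bsub>G\<^esub> (inv_into U \<phi> x)))
          {x. x \<in> \<phi> ` U \<and> inv\<^bsub>G\<^esub> (inv_into U \<phi> x) \<in> W})"

definition group_center :: "('g, 'x) monoid_scheme \<Rightarrow> 'g set" where
  "group_center G = {z \<in> carrier G. \<forall>g\<in>carrier G. z \<otimes>\<^bsub>G\<^esub> g = g \<otimes>\<^bsub>G\<^esub> z}"

section \<open>The Lie algebra of a Lie group\<close>

text \<open>A chart \<open>(U, \<phi>)\<close> with \<open>\<one> \<in> U\<close> identifies the tangent space of \<open>G\<close> at \<open>\<one>\<close> with the
  model space \<open>'v\<close>. All constructions on the Lie algebra are expressed through this identification.\<close>

text \<open>The left-invariant vector field with value \<open>v\<close> at \<open>\<one>\<close>, in chart coordinates (near \<open>\<phi> \<one>\<close>).\<close>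
definition left_invariant_field ::
  "('g, 'x) monoid_scheme \<Rightarrow> 'g set \<Rightarrow> ('g \<Rightarrow> 'v::euclidean_space) \<Rightarrow> 'v \<Rightarrow> 'v \<Rightarrow> 'v" where
  "left_invariant_field G U \<phi> v x =
     frechet_derivative (\<lambda>y. \<phi> (inv_into U \<phi> x \<otimes>\<^bsub>G\<^esub> inv_into U \<phi> y)) (at (\<phi> \<one>\<^bsub>G\<^esub>)) v"

text \<open>Value at \<open>\<one>\<close> of the commutator of the left-invariant fields extending \<open>u\<close> and \<open>v\<close>; in
  coordinates the commutator of vector fields \<open>X\<close>, \<open>Y\<close> is \<open>DY(X) - DX(Y)\<close>.\<close>
definition lie_bracket ::
  "('g, 'x) monoid_scheme \<Rightarrow> 'g set \<Rightarrow> ('g \<Rightarrow> 'v::euclidean_space) \<Rightarrow> 'v \<Rightarrow> 'v \<Rightarrow> 'v" where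
  "lie_bracket G U \<phi> u v =
     frechet_derivative (left_invariant_field G U \<phi> v) (at (\<phi> \<one>\<^bsub>G\<^esub>)) u -
     frechet_derivative (left_invariant_field G U \<phi> u) (at (\<phi> \<one>\<^bsub>G\<^esub>)) v"

definition Ad ::
  "('g, 'x) monoid_scheme \<Rightarrow> 'g set \<Rightarrow> ('g \<Rightarrow> 'v::euclidean_space) \<Rightarrow> 'g \<Rightarrow> 'v \<Rightarrow> 'v" where
  "Ad G U \<phi> g v =
     frechet_derivative (\<lambda>x. \<phi> (g \<otimes>\<^bsub>G\<^esub> inv_into U \<phi> x \<otimes>\<^bsub>G\<^esub> inv\<^bsub>G\<^esub> g)) (at (\<phi> \<one>\<^bsub>G\<^esub>)) v"

definition Ad_centralizer ::
  "('g, 'x) monoid_scheme \<Rightarrow> 'g set \<Rightarrow> ('g \<Rightarrow> 'v::euclidean_space) \<Rightarrow> 'v \<Rightarrow> 'g set" where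
  "Ad_centralizer G U \<phi> H = {g \<in> carrier G. Ad G U \<phi> g H = H}"

section \<open>Simple Lie algebras, Cartan decompositions and restricted roots\<close>

definition lie_algebra :: "('v::real_vector \<Rightarrow> 'v \<Rightarrow> 'v) \<Rightarrow> bool" where
  "lie_algebra br \<longleftrightarrow> bilinear br \<and> (\<forall>X. br X X = 0) \<and>
     (\<forall>X Y Z. br X (br Y Z) + br Y (br Z X) + br Z (br X Y) = 0)"

definition lie_ideal :: "('v::real_vector \<Rightarrow> 'v \<Rightarrow> 'v) \<Rightarrow> 'v set \<Rightarrow> bool" where
  "lie_ideal br I \<longleftrightarrow> subspace I \<and> (\<forall>X. \<forall>Y\<in>I. br X Y \<in> I)"

definition simple_lie_algebra :: "('v::real_vector \<Rightarrow> 'v \<Rightarrow> 'v) \<Rightarrow> bool" where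
  "simple_lie_algebra br \<longleftrightarrow> lie_algebra br \<and> (\<exists>X Y. br X Y \<noteq> 0) \<and>
     (\<forall>I. lie_ideal br I \<longrightarrow> I = {0} \<or> I = UNIV)"

text \<open>The trace of \<open>ad X \<circ> ad Y\<close>; the inner product of \<open>'v\<close> only serves to read off matrix entries.\<close>
definition killing_form :: "('v::euclidean_space \<Rightarrow> 'v \<Rightarrow> 'v) \<Rightarrow> 'v \<Rightarrow> 'v \<Rightarrow> real" where
  "killing_form br X Y = (\<Sum>b\<in>Basis. br X (br Y b) \<bullet> b)"

definition cartan_involution :: "('v::euclidean_space \<Rightarrow> 'v \<Rightarrow> 'v) \<Rightarrow> ('v \<Rightarrow> 'v) \<Rightarrow> bool" where
  "cartan_involution br \<theta> \<longleftrightarrow> linear \<theta> \<and> (\<forall>X. \<theta> (\<theta> X) = X) \<and>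
     (\<forall>X Y. \<theta> (br X Y) = br (\<theta> X) (\<theta> Y)) \<and>
     (\<forall>X. X \<noteq> 0 \<longrightarrow> - killing_form br X (\<theta> X) > 0)"

definition cartan_decomposition ::
  "('v::euclidean_space \<Rightarrow> 'v \<Rightarrow> 'v) \<Rightarrow> 'v set \<Rightarrow> 'v set \<Rightarrow> bool" where
  "cartan_decomposition br p k \<longleftrightarrow>
     (\<exists>\<theta>. cartan_involution br \<theta> \<and> k = {X. \<theta> X = X} \<and> p = {X. \<theta> X = - X})"

definition abelian_subspace :: "('v::real_vector \<Rightarrow> 'v \<Rightarrow> 'v) \<Rightarrow> 'v set \<Rightarrow> bool" where
  "abelian_subspace br a \<longleftrightarrow> subspace a \<and> (\<forall>X\<in>a. \<forall>Y\<in>a. br X Y = 0)"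

definition maximal_abelian_in :: "('v::real_vector \<Rightarrow> 'v \<Rightarrow> 'v) \<Rightarrow> 'v set \<Rightarrow> 'v set \<Rightarrow> bool" where
  "maximal_abelian_in br p a \<longleftrightarrow> abelian_subspace br a \<and> a \<subseteq> p \<and>
     (\<forall>b. abelian_subspace br b \<and> a \<subseteq> b \<and> b \<subseteq> p \<longrightarrow> b = a)"

instantiation "fun" :: (type, real_vector) real_vector
begin

definition scaleR_fun :: "real \<Rightarrow> ('a \<Rightarrow> 'b) \<Rightarrow> 'a \<Rightarrow> 'b" where
  "scaleR_fun c f = (\<lambda>x. c *\<^sub>R f x)"

instance
  by standard (auto simp: scaleR_fun_def plus_fun_def fun_eq_iff algebra_simps)

end

text \<open>The dual \<open>a\<^sup>*\<close> of a subspace \<open>a\<close>: linear functionals on \<open>a\<close>, made into unique functions on the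
  whole type by the value \<open>0\<close> outside \<open>a\<close>. Vector space operations are the pointwise ones.\<close>
definition dual_space :: "'v::real_vector set \<Rightarrow> ('v \<Rightarrow> real) set" where
  "dual_space a = {\<lambda>x. if x \<in> a then f x else 0 | f. linear f}"

definition restricted_roots :: "('v::real_vector \<Rightarrow> 'v \<Rightarrow> 'v) \<Rightarrow> 'v set \<Rightarrow> ('v \<Rightarrow> real) set" where
  "restricted_roots br a =
     {\<alpha> \<in> dual_space a. \<alpha> \<noteq> 0 \<and> (\<exists>X. X \<noteq> 0 \<and> (\<forall>H\<in>a. br H X = \<alpha> H *\<^sub>R X))}"

definition reduced_roots :: "('v \<Rightarrow> real) set \<Rightarrow> ('v \<Rightarrow> real) set" where
  "reduced_roots \<Phi> = {\<alpha> \<in> \<Phi>. (1/2) *\<^sub>R \<alpha> \<notin> \<Phi>}"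

text \<open>The roots of \<open>A = exp a\<close> in the centralizer of \<open>H0\<close>.\<close>
definition roots_vanishing_at :: "('v \<Rightarrow> real) set \<Rightarrow> 'v \<Rightarrow> ('v \<Rightarrow> real) set" where
  "roots_vanishing_at \<Phi> H0 = {\<alpha> \<in> \<Phi>. \<alpha> H0 = 0}"

section \<open>Root systems in the dual of a real vector space\<close>

text \<open>Root systems are taken in \<open>V = a\<^sup>*\<close> in the sense of Bourbaki, so that coroots lie in
  \<open>V\<^sup>* = a\<close> and act on roots by evaluation.\<close>

definition reflects :: "('v \<Rightarrow> real) set \<Rightarrow> ('v \<Rightarrow> real) \<Rightarrow> 'v \<Rightarrow> bool" where
  "reflects R \<alpha> h \<longleftrightarrow> \<alpha> h = 2 \<and> (\<lambda>\<beta>. \<beta> - \<beta> h *\<^sub>R \<alpha>) ` R = R"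

definition root_system :: "'v::real_vector set \<Rightarrow> ('v \<Rightarrow> real) set \<Rightarrow> bool" where
  "root_system a R \<longleftrightarrow> finite R \<and> 0 \<notin> R \<and> R \<subseteq> dual_space a \<and> span R = dual_space a \<and>
     (\<forall>\<alpha>\<in>R. \<exists>h\<in>a. reflects R \<alpha> h \<and> (\<forall>\<beta>\<in>R. \<beta> h \<in> \<int>))"

text \<open>For a root system the coroot is unique, because \<open>R\<close> is finite and spans \<open>a\<^sup>*\<close>.\<close>
definition coroot :: "'v::real_vector set \<Rightarrow> ('v \<Rightarrow> real) set \<Rightarrow> ('v \<Rightarrow> real) \<Rightarrow> 'v" where
  "coroot a R \<alpha> = (THE h. h \<in> a \<and> reflects R \<alpha> h)"

definition reduced_root_system :: "'v::real_vector set \<Rightarrow> ('v \<Rightarrow> real) set \<Rightarrow> bool" where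
  "reduced_root_system a R \<longleftrightarrow> root_system a R \<and>
     (\<forall>\<alpha>\<in>R. \<forall>c. c *\<^sub>R \<alpha> \<in> R \<longrightarrow> c = 1 \<or> c = -1)"

definition reflection ::
  "'v::real_vector set \<Rightarrow> ('v \<Rightarrow> real) set \<Rightarrow> ('v \<Rightarrow> real) \<Rightarrow> ('v \<Rightarrow> real) \<Rightarrow> ('v \<Rightarrow> real)" where
  "reflection a R \<alpha> \<beta> = \<beta> - \<beta> (coroot a R \<alpha>) *\<^sub>R \<alpha>"

inductive_set weyl_group ::
  "'v::real_vector set \<Rightarrow> ('v \<Rightarrow> real) set \<Rightarrow> (('v \<Rightarrow> real) \<Rightarrow> ('v \<Rightarrow> real)) set"
  for a :: "'v set" and R :: "('v \<Rightarrow> real) set" where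
  weyl_id: "id \<in> weyl_group a R"
| weyl_refl: "w \<in> weyl_group a R \<Longrightarrow> \<alpha> \<in> R \<Longrightarrow> reflection a R \<alpha> \<circ> w \<in> weyl_group a R"

text \<open>A base of simple roots: a basis of \<open>a\<^sup>*\<close> consisting of roots, such that every root is an
  integral combination of simple roots with coefficients all of the same sign.\<close>
definition root_base :: "'v::real_vector set \<Rightarrow> ('v \<Rightarrow> real) set \<Rightarrow> ('v \<Rightarrow> real) set \<Rightarrow> bool" where
  "root_base a R \<Delta> \<longleftrightarrow> \<Delta> \<subseteq> R \<and> finite \<Delta> \<and> independent \<Delta> \<and> span \<Delta> = dual_space a \<and>
     (\<forall>\<beta>\<in>R. \<exists>c :: ('v \<Rightarrow> real) \<Rightarrow> nat.
        \<beta> = (\<Sum>\<delta>\<in>\<Delta>. real (c \<delta>) *\<^sub>R \<delta>) \<or> \<beta> = - (\<Sum>\<delta>\<in>\<Delta>. real (c \<delta>) *\<^sub>R \<delta>))"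

definition closed_positive_chamber ::
  "'v set \<Rightarrow> ('v \<Rightarrow> real) set \<Rightarrow> 'v set" where
  "closed_positive_chamber a \<Delta> = {H \<in> a. \<forall>\<alpha>\<in>\<Delta>. \<alpha> H \<ge> 0}"

definition fundamental_coweight ::
  "'v set \<Rightarrow> ('v \<Rightarrow> real) set \<Rightarrow> ('v \<Rightarrow> real) \<Rightarrow> 'v \<Rightarrow> bool" where
  "fundamental_coweight a \<Delta> \<alpha> \<omega> \<longleftrightarrow>
     \<alpha> \<in> \<Delta> \<and> \<omega> \<in> a \<and> (\<forall>\<beta>\<in>\<Delta>. \<beta> \<omega> = (if \<beta> = \<alpha> then 1 else 0))"

section \<open>Types of root systems and extremal elements\<close>

datatype dynkin_type = A_type nat | B_type nat | C_type nat | D_type nat | E7_type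

fun valid_type :: "dynkin_type \<Rightarrow> bool" where
  "valid_type (A_type n) \<longleftrightarrow> n \<ge> 1"
| "valid_type (B_type n) \<longleftrightarrow> n \<ge> 2"
| "valid_type (C_type n) \<longleftrightarrow> n \<ge> 3"
| "valid_type (D_type n) \<longleftrightarrow> n \<ge> 4"
| "valid_type E7_type \<longleftrightarrow> True"

fun type_rank :: "dynkin_type \<Rightarrow> nat" where
  "type_rank (A_type n) = n"
| "type_rank (B_type n) = n"
| "type_rank (C_type n) = n"
| "type_rank (D_type n) = n"
| "type_rank E7_type = 7"

text \<open>Edges \<open>{i, j}\<close> with \<open>i < j\<close> of the Dynkin diagram, in Bourbaki numbering.\<close>
fun dynkin_edge :: "dynkin_type \<Rightarrow> nat \<Rightarrow> nat \<Rightarrow> bool" where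
  "dynkin_edge (A_type n) i j \<longleftrightarrow> j = i + 1"
| "dynkin_edge (B_type n) i j \<longleftrightarrow> j = i + 1"
| "dynkin_edge (C_type n) i j \<longleftrightarrow> j = i + 1"
| "dynkin_edge (D_type n) i j \<longleftrightarrow> (j = i + 1 \<and> j < n) \<or> (i + 2 = j \<and> j = n)"
| "dynkin_edge E7_type i j \<longleftrightarrow> (i, j) \<in> {(1, 3), (3, 4), (2, 4), (4, 5), (5, 6), (6, 7)}"

text \<open>The entry \<open>(i, j)\<close> is \<open>\<langle>\<alpha>\<^sub>i, \<alpha>\<^sub>j\<^sup>\<or>\<rangle> = 2 (\<alpha>\<^sub>i, \<alpha>\<^sub>j) / (\<alpha>\<^sub>j, \<alpha>\<^sub>j)\<close>. The last simple root
  is the short one in type B and the long one in type C.\<close>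
definition cartan_entry :: "dynkin_type \<Rightarrow> nat \<Rightarrow> nat \<Rightarrow> int" where
  "cartan_entry ty i j =
     (if i = j then 2
      else if dynkin_edge ty i j \<or> dynkin_edge ty j i then
        (case ty of
           B_type n \<Rightarrow> (if j = n then -2 else -1)
         | C_type n \<Rightarrow> (if i = n then -2 else -1)
         | _ \<Rightarrow> -1)
      else 0)"

definition bourbaki_numbering ::
  "'v::real_vector set \<Rightarrow> ('v \<Rightarrow> real) set \<Rightarrow> ('v \<Rightarrow> real) set \<Rightarrow> dynkin_type \<Rightarrow> (nat \<Rightarrow> 'v \<Rightarrow> real) \<Rightarrow> bool" where
  "bourbaki_numbering a R \<Delta> ty \<alpha> \<longleftrightarrow>
     bij_betw \<alpha> {1..type_rank ty} \<Delta> \<and>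
     (\<forall>i\<in>{1..type_rank ty}. \<forall>j\<in>{1..type_rank ty}.
        \<alpha> i (coroot a R (\<alpha> j)) = of_int (cartan_entry ty i j))"

definition root_system_of_type ::
  "'v::real_vector set \<Rightarrow> ('v \<Rightarrow> real) set \<Rightarrow> ('v \<Rightarrow> real) set \<Rightarrow> dynkin_type \<Rightarrow> bool" where
  "root_system_of_type a R \<Delta> ty \<longleftrightarrow>
     valid_type ty \<and> reduced_root_system a R \<and> root_base a R \<Delta> \<and>
     (\<exists>\<alpha>. bourbaki_numbering a R \<Delta> ty \<alpha>)"

fun extremal_nodes :: "dynkin_type \<Rightarrow> nat set" where
  "extremal_nodes (A_type n) = {1, n}"
| "extremal_nodes (B_type n) = {1}"
| "extremal_nodes (C_type n) = {1}"
| "extremal_nodes (D_type n) = {1}"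
| "extremal_nodes E7_type = {7}"

text \<open>The Bourbaki numbering is unique up to diagram automorphisms. It is existentially quantified,
  so in type \<open>D\<^sub>4\<close> each of the three outer nodes is extremal.\<close>
definition extremal ::
  "'v::real_vector set \<Rightarrow> ('v \<Rightarrow> real) set \<Rightarrow> ('v \<Rightarrow> real) set \<Rightarrow> 'v \<Rightarrow> bool" where
  "extremal a R \<Delta> H0 \<longleftrightarrow> H0 \<in> closed_positive_chamber a \<Delta> \<and>
     (\<exists>ty \<alpha> i c \<omega>. root_system_of_type a R \<Delta> ty \<and> bourbaki_numbering a R \<Delta> ty \<alpha> \<and>
        i \<in> extremal_nodes ty \<and> fundamental_coweight a \<Delta> (\<alpha> i) \<omega> \<and> c > 0 \<and> H0 = c *\<^sub>R \<omega>)"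

section \<open>Semistandard and semi-dense root subsystems\<close>

definition root_subsystem :: "'v::real_vector set \<Rightarrow> ('v \<Rightarrow> real) set \<Rightarrow> ('v \<Rightarrow> real) set \<Rightarrow> bool" where
  "root_subsystem a R S \<longleftrightarrow> S \<subseteq> R \<and> (\<forall>\<alpha>\<in>S. \<forall>\<beta>\<in>S. reflection a R \<alpha> \<beta> \<in> S)"

definition generated_subsystem ::
  "'v::real_vector set \<Rightarrow> ('v \<Rightarrow> real) set \<Rightarrow> ('v \<Rightarrow> real) set \<Rightarrow> ('v \<Rightarrow> real) set" where
  "generated_subsystem a R I = \<Inter>{S. root_subsystem a R S \<and> I \<subseteq> S}"

definition semistandard ::
  "'v::real_vector set \<Rightarrow> ('v \<Rightarrow> real) set \<Rightarrow> ('v \<Rightarrow> real) set \<Rightarrow> ('v \<Rightarrow> real) set \<Rightarrow> bool" where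
  "semistandard a R \<Delta> \<Psi> \<longleftrightarrow>
     (\<exists>I w. I \<subseteq> \<Delta> \<and> w \<in> weyl_group a R \<and> \<Psi> = w ` generated_subsystem a R I)"

definition root_rank :: "('v \<Rightarrow> real) set \<Rightarrow> nat" where
  "root_rank \<Psi> = dim \<Psi>"

definition semi_dense ::
  "'v::real_vector set \<Rightarrow> ('v \<Rightarrow> real) set \<Rightarrow> ('v \<Rightarrow> real) set \<Rightarrow> ('v \<Rightarrow> real) set \<Rightarrow> bool" where
  "semi_dense a R \<Delta> \<Phi>0 \<longleftrightarrow> semistandard a R \<Delta> \<Phi>0 \<and>
     (\<forall>\<Psi>. semistandard a R \<Delta> \<Psi> \<longrightarrow>
        real (card (\<Psi> \<inter> \<Phi>0)) + real (root_rank \<Psi>) \<ge> (1/2) * real (card \<Psi>))"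

end

theory Submission
  imports Defs
begin

text \<open>
  Write \<open>R\<close> for the reduced restricted root system and \<open>\<omega>\<close> for the extremal fundamental coweight of
  which \<open>H0\<close> is a multiple. The roots of \<open>M\<close> in \<open>R\<close> are those that vanish at \<open>\<omega>\<close>. They form the
  subsystem generated by all simple roots but one (\<open>generated_by_vanishing_simple_roots\<close>), which is semistandard.

  The inequality says that in every semistandard \<open>\<Psi>\<close> the roots that do not vanish at \<open>\<omega>\<close> exceed in
  number those that do by at most twice the rank. It holds for every subset \<open>\<Psi>\<close> of \<open>R\<close> that is closed
  under its own reflections, and is proved there without classifying the subsystems. Suppose that all
  roots of \<open>\<Psi>\<close> have values in \<open>{-1, 0, 1}\<close> at \<open>\<omega>\<close>. Take a longest nonvanishing root \<open>\<beta>\<close>. The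
  reflection in \<open>\<beta>\<close> maps the nonvanishing roots that are neither orthogonal nor equal to \<open>\<plusminus> \<beta>\<close>
  injectively to vanishing roots not orthogonal to \<open>\<beta>\<close>. So only \<open>\<plusminus> \<beta>\<close> and the roots orthogonal
  to \<open>\<beta>\<close> can add to the surplus, and the latter have smaller rank; induction applies
  (\<open>card_nonvanishing_le\<close>).

  The values of the roots at \<open>\<omega>\<close> come from the Cauchy-Schwarz inequality for the invariant form
  \<open>form\<close> on \<open>a\<close>, which gives \<open>(\<beta> \<omega>)^2 * conorm \<beta> \<le> 4 * form \<omega> \<omega>\<close>. Expanding \<open>\<omega>\<close> in simple
  coroots computes \<open>form \<omega> \<omega>\<close>. In types \<open>A\<close>, \<open>B\<close>, \<open>D\<close> and \<open>E7\<close> it is smaller than every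
  \<open>conorm \<beta>\<close>, and the values lie in \<open>{-1, 0, 1}\<close>. In type \<open>C\<close> it equals the \<open>conorm\<close> of the long
  roots, and a root \<open>\<beta>\<close> with value \<open>2\<close> has coroot \<open>\<omega>\<close>; then \<open>\<plusminus> \<beta>\<close> are the only nonvanishing
  long roots. The short roots of \<open>\<Psi>\<close> are handled as before, and any nonvanishing short root reflects
  \<open>\<beta>\<close> to a vanishing long root, which compensates for \<open>\<beta>\<close> (\<open>card_nonvanishing_le_long\<close>).
\<close>

section \<open>The invariant form and the coroots\<close>

locale reduced_system =
  fixes a :: "'v::euclidean_space set" and R :: "('v \<Rightarrow> real) set"
  assumes subspace_a: "subspace a"
    and reduced_root_system: "reduced_root_system a R"
begin

lemma root_system: "root_system a R"
  using reduced_root_system by (simp add: reduced_root_system_def)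

lemma finite_R: "finite R" and R_dual: "R \<subseteq> dual_space a"
  and span_R: "span R = dual_space a"
  using root_system by (simp_all add: root_system_def)

lemma dual_linear:
  assumes "f \<in> dual_space a" "x \<in> a" "y \<in> a"
  shows "f (x + y) = f x + f y" and "f (c *\<^sub>R x) = c * f x" and "f (x - y) = f x - f y"
    and "f (- x) = - f x"
proof -
  obtain g where g: "linear g" and f: "f = (\<lambda>x. if x \<in> a then g x else 0)"
    using assms(1) by (auto simp: dual_space_def)
  have mem: "x + y \<in> a" "c *\<^sub>R x \<in> a" "x - y \<in> a" "- x \<in> a"
    using subspace_a assms(2,3)
    by (auto intro: subspace_add subspace_scale subspace_diff subspace_neg)
  show "f (x + y) = f x + f y" "f (c *\<^sub>R x) = c * f x" "f (x - y) = f x - f y" "f (- x) = - f x"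
    using mem assms(2,3)
    by (simp_all add: f linear_add[OF g] linear_diff[OF g] linear_scale[OF g] linear_neg[OF g])
qed

lemmas root_linear = dual_linear[OF subsetD[OF R_dual]]

lemma dual_eqI:
  assumes "f \<in> dual_space a" "g \<in> dual_space a" "\<And>x. x \<in> a \<Longrightarrow> f x = g x"
  shows "f = g"
proof
  fix x
  show "f x = g x"
    using assms by (cases "x \<in> a") (auto simp: dual_space_def)
qed

text \<open>The inner product with \<open>h\<close> restricts to an element of the dual space, so it is a combination of
  functionals that vanish at \<open>h\<close>.\<close>
lemma separated_by_spanning_set:
  assumes span: "span B = dual_space a" and h: "h \<in> a" and zero: "\<And>\<beta>. \<beta> \<in> B \<Longrightarrow> \<beta> h = 0"
  shows "h = 0"
proof -
  let ?f = "\<lambda>x. if x \<in> a then h \<bullet> x else 0"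
  have "?f \<in> dual_space a"
    by (auto simp: dual_space_def intro!: exI[of _ "\<lambda>x. h \<bullet> x"] bounded_linear_inner_right bounded_linear.linear)
  then have "?f \<in> span B"
    using span by simp
  then have "?f h = 0"
  proof (induction rule: span_induct)
    case base
    show ?case
      by (auto simp: subspace_def scaleR_fun_def)
  next
    case (step \<beta>)
    then show ?case by (simp add: zero)
  qed
  then show ?thesis using h by simp
qed

text \<open>Every reflection permutes \<open>R\<close>, so this form on \<open>a\<close> is invariant under all of them. It takes
  the place of an inner product and is defined before any uniqueness of coroots is known.\<close>
definition form :: "'v \<Rightarrow> 'v \<Rightarrow> real" where
  "form x y = (\<Sum>\<gamma>\<in>R. \<gamma> x * \<gamma> y)"

lemma form_commute: "form x y = form y x"
  by (simp add: form_def mult.commute)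

lemma form_linear:
  assumes "x \<in> a" "y \<in> a"
  shows "form (x + y) z = form x z + form y z" and "form (c *\<^sub>R x) z = c * form x z"
    and "form (x - y) z = form x z - form y z"
  using assms by (simp_all add: form_def root_linear sum.distrib sum_subtractf algebra_simps
      sum_distrib_left)

lemma form_linear_right:
  assumes "x \<in> a" "y \<in> a"
  shows "form z (x + y) = form z x + form z y" and "form z (c *\<^sub>R x) = c * form z x"
    and "form z (x - y) = form z x - form z y"
  using form_linear[OF assms] by (simp_all add: form_commute[of z])

lemma form_zero_left: "form 0 z = 0"
  using form_linear(2)[of 0 0 0 z] subspace_0[OF subspace_a] by simp

lemma form_sum_right:
  assumes "\<And>j. j \<in> J \<Longrightarrow> x j \<in> a"
  shows "form z (\<Sum>j\<in>J. x j) = (\<Sum>j\<in>J. form z (x j))"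
  using assms
proof (induction J rule: infinite_finite_induct)
  case (insert j J)
  then show ?case
    by (simp add: form_linear_right subspace_sum[OF subspace_a])
qed (simp_all add: form_commute[of z] form_zero_left)

lemma form_nonneg: "form x x \<ge> 0"
  by (simp add: form_def sum_nonneg)

lemma form_definite:
  assumes "x \<in> a" "form x x \<le> 0"
  shows "x = 0"
proof (rule separated_by_spanning_set[OF span_R assms(1)])
  have "form x x = 0"
    using assms(2) form_nonneg[of x] by simp
  then show "\<gamma> x = 0" if "\<gamma> \<in> R" for \<gamma>
    using that finite_R by (simp add: form_def sum_nonneg_eq_0_iff)
qed

text \<open>Invariance under the reflection in \<open>h\<close> gives \<open>form x h = form (s x) (- h)\<close>, where
  \<open>s x = x - \<alpha> x h\<close>.\<close>
lemma form_reflects: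
  assumes "reflects R \<alpha> h"
  shows "2 * form x h = \<alpha> x * form h h"
proof -
  let ?s = "\<lambda>\<beta>. \<beta> - \<beta> h *\<^sub>R \<alpha>"
  have h: "\<alpha> h = 2" and img: "?s ` R = R"
    using assms by (auto simp: reflects_def)
  have inj: "inj_on ?s R"
    by (rule eq_card_imp_inj_on[OF finite_R]) (simp add: img)
  have "form x h = (\<Sum>\<gamma>\<in>?s ` R. \<gamma> x * \<gamma> h)"
    by (simp add: img form_def)
  also have "\<dots> = (\<Sum>\<gamma>\<in>R. ?s \<gamma> x * ?s \<gamma> h)"
    by (simp add: sum.reindex[OF inj])
  also have "\<dots> = (\<Sum>\<gamma>\<in>R. \<alpha> x * (\<gamma> h * \<gamma> h) - \<gamma> x * \<gamma> h)"
    by (rule sum.cong) (auto simp: scaleR_fun_def h algebra_simps)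
  also have "\<dots> = \<alpha> x * form h h - form x h"
    by (simp add: form_def sum_subtractf sum_distrib_left)
  finally show ?thesis by simp
qed

lemma reflects_unique:
  assumes "h \<in> a" "h' \<in> a" "reflects R \<alpha> h" "reflects R \<alpha> h'"
  shows "h = h'"
proof -
  have "\<alpha> h = 2" "\<alpha> h' = 2"
    using assms(3,4) by (auto simp: reflects_def)
  then have "form h' h = form h h" "form h h' = form h' h'"
    using form_reflects[OF assms(3), of h'] form_reflects[OF assms(4), of h] by simp_all
  then have "form (h - h') (h - h') = 0"
    using assms(1,2) by (simp add: form_linear form_linear_right)
  then have "h - h' = 0"
    using form_definite[of "h - h'"] assms(1,2) subspace_diff[OF subspace_a] by simp
  then show ?thesis by simp
qed

abbreviation cr :: "('v \<Rightarrow> real) \<Rightarrow> 'v" where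
  "cr \<equiv> coroot a R"

abbreviation refl :: "('v \<Rightarrow> real) \<Rightarrow> ('v \<Rightarrow> real) \<Rightarrow> ('v \<Rightarrow> real)" where
  "refl \<equiv> reflection a R"

text \<open>The squared length of the coroot. It is inversely proportional to the squared length of the root,
  so long roots have small \<open>conorm\<close>.\<close>
abbreviation conorm :: "('v \<Rightarrow> real) \<Rightarrow> real" where
  "conorm \<alpha> \<equiv> form (cr \<alpha>) (cr \<alpha>)"

lemma coroot_eqI:
  assumes "h \<in> a" "reflects R \<alpha> h"
  shows "cr \<alpha> = h"
  unfolding coroot_def
  by (rule the_equality) (use assms reflects_unique in blast)+

lemma
  assumes "\<alpha> \<in> R"
  shows coroot_mem: "cr \<alpha> \<in> a" and coroot_reflects: "reflects R \<alpha> (cr \<alpha>)"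
    and root_coroot_Ints: "\<beta> \<in> R \<Longrightarrow> \<beta> (cr \<alpha>) \<in> \<int>"
proof -
  obtain h where h: "h \<in> a" "reflects R \<alpha> h" "\<forall>\<beta>\<in>R. \<beta> h \<in> \<int>"
    using root_system assms unfolding root_system_def by blast
  then have "cr \<alpha> = h"
    using coroot_eqI by blast
  then show "cr \<alpha> \<in> a" "reflects R \<alpha> (cr \<alpha>)" "\<beta> \<in> R \<Longrightarrow> \<beta> (cr \<alpha>) \<in> \<int>"
    using h by auto
qed

lemma root_coroot_self: "\<alpha> \<in> R \<Longrightarrow> \<alpha> (cr \<alpha>) = 2"
  using coroot_reflects by (auto simp: reflects_def)

lemma form_coroot: "\<alpha> \<in> R \<Longrightarrow> 2 * form x (cr \<alpha>) = \<alpha> x * conorm \<alpha>"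
  by (rule form_reflects[OF coroot_reflects])

lemma pairing_symmetry:
  assumes "\<alpha> \<in> R" "\<beta> \<in> R"
  shows "\<alpha> (cr \<beta>) * conorm \<alpha> = \<beta> (cr \<alpha>) * conorm \<beta>"
  using form_coroot[OF assms(1), of "cr \<beta>"] form_coroot[OF assms(2), of "cr \<alpha>"]
  by (simp add: form_commute)

lemma conorm_pos:
  assumes "\<alpha> \<in> R"
  shows "conorm \<alpha> > 0"
proof (rule ccontr)
  assume "\<not> conorm \<alpha> > 0"
  then have "cr \<alpha> = 0"
    using form_definite coroot_mem[OF assms] by simp
  moreover have "\<alpha> 0 = 0"
    using root_linear(2)[OF assms, of 0 0 0] subspace_0[OF subspace_a] by simp
  ultimately show False
    using root_coroot_self[OF assms] by simp
qed

lemma root_eq_of_coroot_eq: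
  assumes "\<alpha> \<in> R" "\<beta> \<in> R" "cr \<alpha> = cr \<beta>"
  shows "\<alpha> = \<beta>"
proof (rule dual_eqI)
  show "\<alpha> \<in> dual_space a" "\<beta> \<in> dual_space a"
    using assms R_dual by auto
  show "\<alpha> x = \<beta> x" for x
    using form_coroot[OF assms(1), of x] form_coroot[OF assms(2), of x] assms(3)
      conorm_pos[OF assms(1)] by simp
qed

lemma refl_apply: "refl \<alpha> \<beta> x = \<beta> x - \<beta> (cr \<alpha>) * \<alpha> x"
  by (simp add: reflection_def scaleR_fun_def)

lemma refl_image: "\<alpha> \<in> R \<Longrightarrow> refl \<alpha> ` R = R"
  using coroot_reflects unfolding reflects_def reflection_def by simp

lemma refl_mem: "\<alpha> \<in> R \<Longrightarrow> \<beta> \<in> R \<Longrightarrow> refl \<alpha> \<beta> \<in> R"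
  using refl_image by blast

lemma refl_refl: "\<alpha> \<in> R \<Longrightarrow> refl \<alpha> (refl \<alpha> \<beta>) = \<beta>"
  by (rule ext) (simp add: refl_apply root_coroot_self)

lemma inj_refl: "\<alpha> \<in> R \<Longrightarrow> inj (refl \<alpha>)"
  using refl_refl by (metis injI)

lemma refl_self: "\<alpha> \<in> R \<Longrightarrow> refl \<alpha> \<alpha> = - \<alpha>"
  by (rule ext) (simp add: refl_apply root_coroot_self)

lemma uminus_root: "\<alpha> \<in> R \<Longrightarrow> - \<alpha> \<in> R"
  using refl_mem[of \<alpha> \<alpha>] by (simp add: refl_self)

lemma root_neq_uminus:
  assumes "\<alpha> \<in> R"
  shows "\<alpha> \<noteq> - \<alpha>"
proof
  assume "\<alpha> = - \<alpha>"
  then have "\<alpha> (cr \<alpha>) = (- \<alpha>) (cr \<alpha>)"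
    by (rule fun_cong)
  then show False
    using root_coroot_self[OF assms] by simp
qed

text \<open>Conjugating \<open>refl \<alpha>\<close> by \<open>refl \<gamma>\<close> gives the reflection in \<open>refl \<gamma> \<alpha>\<close>; uniqueness of coroots
  then identifies its coroot.\<close>
lemma coroot_refl:
  assumes "\<gamma> \<in> R" "\<alpha> \<in> R"
  shows "cr (refl \<gamma> \<alpha>) = cr \<alpha> - \<gamma> (cr \<alpha>) *\<^sub>R cr \<gamma>" (is "_ = ?h")
proof (rule coroot_eqI)
  note mem = coroot_mem[OF assms(1)] coroot_mem[OF assms(2)]
  show "?h \<in> a"
    using mem by (simp add: subspace_a subspace_diff subspace_scale)
  have ev: "\<beta> ?h = \<beta> (cr \<alpha>) - \<gamma> (cr \<alpha>) * \<beta> (cr \<gamma>)" if "\<beta> \<in> R" for \<beta>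
    using mem that by (simp add: root_linear subspace_scale[OF subspace_a])
  have conj: "\<beta> - \<beta> ?h *\<^sub>R refl \<gamma> \<alpha> = refl \<gamma> (refl \<alpha> (refl \<gamma> \<beta>))" if "\<beta> \<in> R" for \<beta>
    by (rule ext) (simp add: ev[OF that] refl_apply scaleR_fun_def root_coroot_self[OF assms(1)]
        root_coroot_self[OF assms(2)] algebra_simps)
  have "(\<lambda>\<beta>. \<beta> - \<beta> ?h *\<^sub>R refl \<gamma> \<alpha>) ` R = refl \<gamma> ` (refl \<alpha> ` (refl \<gamma> ` R))"
    unfolding image_image by (rule image_cong) (simp_all add: conj)
  also have "\<dots> = R"
    by (simp add: refl_image assms)
  finally show "reflects R (refl \<gamma> \<alpha>) ?h"
    unfolding reflects_def
    using ev[OF refl_mem[OF assms]]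
    by (simp add: refl_apply root_coroot_self[OF assms(1)] root_coroot_self[OF assms(2)]
        algebra_simps)
qed

lemma coroot_uminus:
  assumes "\<alpha> \<in> R"
  shows "cr (- \<alpha>) = - cr \<alpha>"
  using coroot_refl[OF assms assms]
  by (simp add: refl_self[OF assms] root_coroot_self[OF assms] scaleR_2)

lemma conorm_refl:
  assumes "\<gamma> \<in> R" "\<alpha> \<in> R"
  shows "conorm (refl \<gamma> \<alpha>) = conorm \<alpha>"
proof -
  note mem = coroot_mem[OF assms(1)] coroot_mem[OF assms(2)]
  let ?c = "\<gamma> (cr \<alpha>)"
  have scaled: "?c *\<^sub>R cr \<gamma> \<in> a"
    using mem by (simp add: subspace_a subspace_scale)
  have "conorm (refl \<gamma> \<alpha>) = conorm \<alpha> - ?c * (2 * form (cr \<alpha>) (cr \<gamma>)) + ?c * ?c * conorm \<gamma>"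
    using mem scaled
    by (simp add: coroot_refl[OF assms] form_linear form_linear_right form_commute[of "cr \<gamma>" "cr \<alpha>"]
        algebra_simps)
  also have "\<dots> = conorm \<alpha>"
    by (simp add: form_coroot[OF assms(1)])
  finally show ?thesis .
qed

lemma conorm_uminus: "\<alpha> \<in> R \<Longrightarrow> conorm (- \<alpha>) = conorm \<alpha>"
  using conorm_refl[of \<alpha> \<alpha>] by (simp add: refl_self)

text \<open>The two sides differ by four times the squared length of \<open>x - (\<beta> x / 2) cr \<beta>\<close>, the component of
  \<open>x\<close> orthogonal to \<open>cr \<beta>\<close>.\<close>
lemma cauchy_schwarz_coroot:
  assumes "x \<in> a" "\<beta> \<in> R"
  shows "(\<beta> x)\<^sup>2 * conorm \<beta> \<le> 4 * form x x"
    and "(\<beta> x)\<^sup>2 * conorm \<beta> = 4 * form x x \<Longrightarrow> x = (\<beta> x / 2) *\<^sub>R cr \<beta>"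
proof -
  let ?y = "x - (\<beta> x / 2) *\<^sub>R cr \<beta>"
  have mem: "cr \<beta> \<in> a" "(\<beta> x / 2) *\<^sub>R cr \<beta> \<in> a" "?y \<in> a"
    using coroot_mem[OF assms(2)] assms(1) by (simp_all add: subspace_a subspace_scale subspace_diff)
  have "form ?y ?y = form x x - (\<beta> x / 2) * (2 * form x (cr \<beta>)) + (\<beta> x / 2) * (\<beta> x / 2) * conorm \<beta>"
    using mem assms(1)
    by (simp add: form_linear form_linear_right form_commute[of "cr \<beta>" x] algebra_simps)
  also have "\<dots> = form x x - (\<beta> x)\<^sup>2 * conorm \<beta> / 4"
    by (simp add: form_coroot[OF assms(2)] power2_eq_square)
  finally have y: "form ?y ?y = form x x - (\<beta> x)\<^sup>2 * conorm \<beta> / 4" .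
  show "(\<beta> x)\<^sup>2 * conorm \<beta> \<le> 4 * form x x"
    using y form_nonneg[of ?y] by simp
  show "x = (\<beta> x / 2) *\<^sub>R cr \<beta>" if "(\<beta> x)\<^sup>2 * conorm \<beta> = 4 * form x x"
  proof -
    have "?y = 0"
      using form_definite[OF mem(3)] y that by simp
    then show ?thesis by simp
  qed
qed

section \<open>Root subsystems\<close>

lemma root_subsystemD:
  assumes "root_subsystem a R S"
  shows "S \<subseteq> R" "\<And>\<alpha> \<beta>. \<alpha> \<in> S \<Longrightarrow> \<beta> \<in> S \<Longrightarrow> refl \<alpha> \<beta> \<in> S" "\<And>\<alpha>. \<alpha> \<in> S \<Longrightarrow> - \<alpha> \<in> S" "finite S"
proof -
  show sub: "S \<subseteq> R" and closed: "\<And>\<alpha> \<beta>. \<alpha> \<in> S \<Longrightarrow> \<beta> \<in> S \<Longrightarrow> refl \<alpha> \<beta> \<in> S"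
    using assms by (auto simp: root_subsystem_def)
  show "- \<alpha> \<in> S" if "\<alpha> \<in> S" for \<alpha>
    using closed[OF that that] refl_self sub that by (simp add: subset_iff)
  show "finite S"
    using sub finite_R finite_subset by blast
qed

lemma root_subsystem_generated:
  assumes "I \<subseteq> R"
  shows "root_subsystem a R (generated_subsystem a R I)"
proof -
  have "root_subsystem a R R"
    by (simp add: root_subsystem_def refl_mem)
  then show ?thesis
    using assms unfolding generated_subsystem_def root_subsystem_def by blast
qed

lemma root_subsystem_refl_image:
  assumes S: "root_subsystem a R S" and g: "\<gamma> \<in> R"
  shows "root_subsystem a R (refl \<gamma> ` S)"
proof -
  note sub = root_subsystemD(1)[OF S]
  have conj: "refl (refl \<gamma> \<alpha>) (refl \<gamma> \<beta>) = refl \<gamma> (refl \<alpha> \<beta>)" if "\<alpha> \<in> S" "\<beta> \<in> S" for \<alpha> \<beta>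
  proof -
    have R: "\<alpha> \<in> R" "\<beta> \<in> R" "refl \<gamma> \<beta> \<in> R"
      using that sub g refl_mem by auto
    have "\<gamma> (cr \<alpha>) *\<^sub>R cr \<gamma> \<in> a"
      using coroot_mem[OF g] by (simp add: subspace_scale[OF subspace_a])
    then have "refl \<gamma> \<beta> (cr (refl \<gamma> \<alpha>)) = \<beta> (cr \<alpha>)"
      by (simp add: coroot_refl[OF g R(1)] root_linear R g coroot_mem)
        (simp add: refl_apply root_coroot_self[OF g] algebra_simps)
    then show ?thesis
      by (intro ext) (simp add: refl_apply[of "refl \<gamma> \<alpha>"], simp add: refl_apply algebra_simps)
  qed
  show ?thesis
    using sub g root_subsystemD(2)[OF S]
    by (auto simp: root_subsystem_def refl_mem conj)
qed

lemma root_subsystem_semistandard: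
  assumes "\<Delta> \<subseteq> R" "semistandard a R \<Delta> \<Psi>"
  shows "root_subsystem a R \<Psi>"
proof -
  obtain I w where I: "I \<subseteq> \<Delta>" and w: "w \<in> weyl_group a R" and
    \<Psi>: "\<Psi> = w ` generated_subsystem a R I"
    using assms(2) by (auto simp: semistandard_def)
  from w have "root_subsystem a R (w ` generated_subsystem a R I)"
  proof induction
    case weyl_id
    then show ?case
      using root_subsystem_generated I assms(1) by simp
  next
    case (weyl_refl w \<alpha>)
    show ?case
      unfolding image_comp[symmetric]
      using root_subsystem_refl_image[OF weyl_refl.IH weyl_refl.hyps(2)] .
  qed
  then show ?thesis by (simp add: \<Psi>)
qed

lemma root_subsystem_orthogonal:
  assumes S: "root_subsystem a R S"
  shows "root_subsystem a R {\<gamma> \<in> S. \<gamma> h = 0}"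
  using root_subsystemD(1,2)[OF S] by (auto simp: root_subsystem_def refl_apply)

lemma root_subsystem_conorm:
  assumes S: "root_subsystem a R S"
  shows "root_subsystem a R {\<gamma> \<in> S. conorm \<gamma> \<noteq> c}"
  using root_subsystemD(1,2)[OF S] by (auto simp: root_subsystem_def conorm_refl subset_iff)

lemma dim_mono_finite:
  assumes "S' \<subseteq> S" "finite (S :: ('v \<Rightarrow> real) set)"
  shows "dim S' \<le> dim S"
proof -
  obtain B where B: "B \<subseteq> S" "S \<subseteq> span B" "card B = dim S"
    by (rule basis_exists)
  have "finite B"
    using B(1) assms(2) by (rule finite_subset)
  moreover have "S' \<subseteq> span B"
    using assms(1) B(2) by blast
  ultimately show ?thesis
    using dim_le_card[of S' B] B(3) by simp
qed

lemma dim_orthogonal_less: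
  assumes S: "finite S" "\<beta> \<in> S" "\<beta> h \<noteq> 0"
  shows "dim {\<gamma> \<in> S. \<gamma> h = 0} + 1 \<le> dim (S :: ('v \<Rightarrow> real) set)"
proof -
  obtain B where B: "B \<subseteq> {\<gamma> \<in> S. \<gamma> h = 0}" "independent B" "card B = dim {\<gamma> \<in> S. \<gamma> h = 0}"
    by (rule basis_exists)
  have "\<gamma> h = 0" if "\<gamma> \<in> span B" for \<gamma>
    using that
  proof (induction rule: span_induct)
    case base
    show ?case by (auto simp: subspace_def scaleR_fun_def)
  next
    case (step \<gamma>)
    then show ?case using B(1) by auto
  qed
  then have notin: "\<beta> \<notin> span B"
    using S(3) by blast
  then have ind: "independent (insert \<beta> B)"
    using B(2) independent_insertI by blast
  have "finite B"
    by (rule finite_subset[OF B(1)]) (use S(1) in simp)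
  moreover have "\<beta> \<notin> B"
    using notin span_base by blast
  ultimately have "card (insert \<beta> B) = dim {\<gamma> \<in> S. \<gamma> h = 0} + 1"
    by (simp add: B(3))
  moreover have "dim (insert \<beta> B) \<le> dim S"
    using B(1) S by (intro dim_mono_finite) auto
  ultimately show ?thesis
    using dim_eq_card_independent[OF ind] by simp
qed

section \<open>The counting inequality\<close>

text \<open>The difference of the two coroots has squared length \<open>conorm \<beta> - conorm \<gamma>\<close>, which the
  hypotheses force to be zero.\<close>
lemma root_eq_of_pairing_2:
  assumes R: "\<beta> \<in> R" "\<gamma> \<in> R" and le: "conorm \<beta> \<le> conorm \<gamma>" and two: "\<gamma> (cr \<beta>) = 2"
  shows "\<gamma> = \<beta>"
proof -
  note mem = coroot_mem[OF R(1)] coroot_mem[OF R(2)]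
  have "form (cr \<beta> - cr \<gamma>) (cr \<beta> - cr \<gamma>) = conorm \<beta> + conorm \<gamma> - 2 * form (cr \<beta>) (cr \<gamma>)"
    using mem by (simp add: form_linear form_linear_right form_commute[of "cr \<gamma>" "cr \<beta>"])
  also have "\<dots> = conorm \<beta> - conorm \<gamma>"
    using form_coroot[OF R(2), of "cr \<beta>"] by (simp add: two)
  finally have "cr \<beta> - cr \<gamma> = 0"
    using le mem by (intro form_definite) (auto intro: subspace_diff[OF subspace_a])
  then show ?thesis
    using root_eq_of_coroot_eq[OF R] by simp
qed

lemma Ints_abs_cases:
  fixes x :: real
  assumes "x \<in> \<int>" "\<bar>x\<bar> < 3"
  shows "x \<in> {-2, -1, 0, 1, 2}"
proof -
  obtain k :: int where k: "x = of_int k"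
    using assms(1) by (elim Ints_cases)
  then have "\<bar>k\<bar> < 3"
    using assms(2) by linarith
  then have "k \<in> {-2, -1, 0, 1, 2}"
    by auto
  then show ?thesis using k by auto
qed

text \<open>Among the roots of \<open>S\<close> that are nonzero at \<open>\<mu>\<close>, let \<open>\<beta>\<close> be a longest one, that is, one with
  least \<open>conorm\<close>. Let \<open>\<gamma>\<close> be another one, not orthogonal to \<open>\<beta>\<close> and different from \<open>- \<beta>\<close>. The
  values of \<open>\<gamma>\<close> and \<open>refl \<beta> \<gamma>\<close> at \<open>\<mu>\<close> differ by \<open>\<gamma> (cr \<beta>) * \<beta> \<mu>\<close> and both lie in \<open>{-1, 0, 1}\<close>;
  since the pairing is not \<open>\<plusminus> 2\<close> by the choice of \<open>\<beta>\<close>, the second value must be \<open>0\<close>. So the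
  reflection injects these roots into the vanishing roots not orthogonal to \<open>\<beta>\<close>, and the surplus of
  nonvanishing over vanishing roots drops by at most two (for \<open>\<beta>\<close> and \<open>- \<beta>\<close>) on passing to the
  roots orthogonal to \<open>\<beta>\<close>, whose rank is smaller.\<close>
lemma card_nonvanishing_le:
  assumes "root_subsystem a R S" and "\<And>\<gamma>. \<gamma> \<in> S \<Longrightarrow> \<gamma> \<mu> \<in> {-1, 0, 1}"
  shows "card {\<gamma> \<in> S. \<gamma> \<mu> \<noteq> 0} \<le> card {\<gamma> \<in> S. \<gamma> \<mu> = 0} + 2 * dim S"
  using assms
proof (induction "card S" arbitrary: S rule: less_induct)
  case less
  note S = root_subsystemD[OF less.prems(1)] and val = less.prems(2)
  show ?case
  proof (cases "{\<gamma> \<in> S. \<gamma> \<mu> \<noteq> 0} = {}")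
    case True
    show ?thesis unfolding True by simp
  next
    case False
    let ?Y = "{\<gamma> \<in> S. \<gamma> \<mu> \<noteq> 0}" and ?Z = "{\<gamma> \<in> S. \<gamma> \<mu> = 0}"
    have "finite (conorm ` ?Y)" "conorm ` ?Y \<noteq> {}"
      using False S(4) by auto
    then have "Min (conorm ` ?Y) \<in> conorm ` ?Y"
      by (rule Min_in)
    then obtain \<beta> where \<beta>: "\<beta> \<in> S" "\<beta> \<mu> \<noteq> 0" and min': "Min (conorm ` ?Y) = conorm \<beta>"
      by blast
    have min: "conorm \<beta> \<le> conorm \<gamma>" if "\<gamma> \<in> S" "\<gamma> \<mu> \<noteq> 0" for \<gamma>
      unfolding min'[symmetric] using that S(4) by (intro Min_le) auto
    have \<beta>R: "\<beta> \<in> R" using \<beta> S(1) by blast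
    let ?S' = "{\<gamma> \<in> S. \<gamma> (cr \<beta>) = 0}"
    let ?Y' = "{\<gamma> \<in> ?S'. \<gamma> \<mu> \<noteq> 0}" and ?Z' = "{\<gamma> \<in> ?S'. \<gamma> \<mu> = 0}"
    let ?Y1 = "{\<gamma> \<in> S. \<gamma> (cr \<beta>) \<noteq> 0 \<and> \<gamma> \<mu> \<noteq> 0 \<and> \<gamma> \<noteq> \<beta> \<and> \<gamma> \<noteq> - \<beta>}"
    let ?Z1 = "{\<gamma> \<in> S. \<gamma> (cr \<beta>) \<noteq> 0 \<and> \<gamma> \<mu> = 0}"
    have "\<beta> \<notin> ?S'"
      using root_coroot_self[OF \<beta>R] by simp
    then have "?S' \<subset> S"
      using \<beta>(1) by blast
    then have "card ?S' < card S"
      using S(4) psubset_card_mono by blast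
    then have IH: "card ?Y' \<le> card ?Z' + 2 * dim ?S'"
      using less.hyps[of ?S'] root_subsystem_orthogonal[OF less.prems(1)] val by simp
    have rank: "dim ?S' + 1 \<le> dim S"
      using dim_orthogonal_less[OF S(4) \<beta>(1)] root_coroot_self[OF \<beta>R] by simp
    have vanish: "refl \<beta> \<gamma> \<mu> = 0" if \<gamma>: "\<gamma> \<in> ?Y1" for \<gamma>
    proof -
      let ?m = "\<gamma> (cr \<beta>)"
      have \<gamma>R: "\<gamma> \<in> R" using \<gamma> S(1) by auto
      have "refl \<beta> \<gamma> \<mu> \<in> {-1, 0, 1}" "\<gamma> \<mu> \<in> {-1, 0, 1}" "\<beta> \<mu> \<in> {-1, 0, 1}"
        using \<gamma> \<beta>(1) S(2) val by auto
      moreover have "?m \<noteq> 2"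
        using root_eq_of_pairing_2[OF \<beta>R \<gamma>R] min \<gamma> by auto
      moreover have "?m \<noteq> -2"
      proof
        assume "?m = -2"
        then have "- \<gamma> = \<beta>"
          using root_eq_of_pairing_2[OF \<beta>R uminus_root[OF \<gamma>R]] conorm_uminus[OF \<gamma>R] min \<gamma>
          by auto
        then show False
          using \<gamma> by auto
      qed
      moreover have "?m \<noteq> 0" "\<gamma> \<mu> \<noteq> 0"
        using \<gamma> by auto
      ultimately show ?thesis
        using \<beta>(2) by (auto simp: refl_apply)
    qed
    have "refl \<beta> ` ?Y1 \<subseteq> ?Z1"
    proof clarify
      fix \<gamma> assume \<gamma>: "\<gamma> \<in> S" "\<gamma> (cr \<beta>) \<noteq> 0" "\<gamma> \<mu> \<noteq> 0" "\<gamma> \<noteq> \<beta>" "\<gamma> \<noteq> - \<beta>"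
      then show "refl \<beta> \<gamma> \<in> S \<and> refl \<beta> \<gamma> (cr \<beta>) \<noteq> 0 \<and> refl \<beta> \<gamma> \<mu> = 0"
        using vanish S(2) \<beta>(1) by (simp add: refl_apply[of _ _ "cr \<beta>"] root_coroot_self[OF \<beta>R])
    qed
    then have inj: "card ?Y1 \<le> card ?Z1"
      using S(4) inj_refl[OF \<beta>R]
      by (intro card_inj_on_le[of "refl \<beta>"]) (auto intro: inj_on_subset)
    have "?Y = ?Y' \<union> ?Y1 \<union> {\<beta>, - \<beta>}"
      using \<beta> S(3) root_coroot_self[OF \<beta>R] by auto
    then have "card ?Y \<le> card (?Y' \<union> ?Y1) + card {\<beta>, - \<beta>}"
      by (simp only: card_Un_le)
    also have "\<dots> \<le> card ?Y' + card ?Y1 + 2"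
      using card_Un_le[of ?Y' ?Y1] by (simp add: card_insert_if)
    finally have Y: "card ?Y \<le> card ?Y' + card ?Y1 + 2" .
    have "?Z = ?Z' \<union> ?Z1" by auto
    then have Z: "card ?Z = card ?Z' + card ?Z1"
      using S(4) by (simp add: card_Un_disjoint disjoint_iff)
    show ?thesis
      using IH rank inj Y Z by linarith
  qed
qed

text \<open>The roots of type \<open>C\<close> with respect to the coroot of a long root \<open>\<beta>\<close>: by the parity hypothesis
  only \<open>\<plusminus> \<beta>\<close> are long and nonvanishing, so every other nonvanishing \<open>\<gamma>\<close> is short. If there is one,
  then \<open>refl \<gamma> \<beta>\<close> is long and vanishes, and together with its negative it makes up for \<open>\<plusminus> \<beta>\<close> in
  the count; the short roots form a subsystem to which \<open>card_nonvanishing_le\<close> applies.\<close>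
lemma card_nonvanishing_le_long:
  assumes "root_subsystem a R S" and \<beta>: "\<beta> \<in> S"
    and val: "\<And>\<gamma>. \<gamma> \<in> R \<Longrightarrow> \<bar>\<gamma> (cr \<beta>)\<bar> < 2 \<or> \<gamma> = \<beta> \<or> \<gamma> = - \<beta>"
    and long: "\<And>\<gamma>. \<gamma> \<in> R \<Longrightarrow> conorm \<gamma> = conorm \<beta> \<Longrightarrow> \<gamma> (cr \<beta>) / 2 \<in> \<int>"
    and short: "\<And>\<gamma>. \<gamma> \<in> R \<Longrightarrow> conorm \<gamma> \<noteq> conorm \<beta> \<Longrightarrow> conorm \<gamma> = 2 * conorm \<beta>"
  shows "card {\<gamma> \<in> S. \<gamma> (cr \<beta>) \<noteq> 0} \<le> card {\<gamma> \<in> S. \<gamma> (cr \<beta>) = 0} + 2 * dim S"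
proof -
  note S = root_subsystemD[OF assms(1)]
  have \<beta>R: "\<beta> \<in> R" using \<beta> S(1) by blast
  let ?Y = "{\<gamma> \<in> S. \<gamma> (cr \<beta>) \<noteq> 0}" and ?Z = "{\<gamma> \<in> S. \<gamma> (cr \<beta>) = 0}"
  have unit: "\<gamma> (cr \<beta>) \<in> {-1, 0, 1}" if "\<gamma> \<in> R" "\<gamma> \<noteq> \<beta>" "\<gamma> \<noteq> - \<beta>" for \<gamma>
    using Ints_abs_cases[OF root_coroot_Ints[OF \<beta>R that(1)]] val[OF that(1)] that by auto
  have equal_length: "\<gamma> (cr \<beta>) = 0"
    if "\<gamma> \<in> R" "\<gamma> \<noteq> \<beta>" "\<gamma> \<noteq> - \<beta>" "conorm \<gamma> = conorm \<beta>" for \<gamma>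
    using Ints_nonzero_abs_less1[OF long[OF that(1,4)]] unit[OF that(1-3)] by auto
  show ?thesis
  proof (cases "\<exists>\<gamma>\<in>S. \<gamma> (cr \<beta>) \<noteq> 0 \<and> \<gamma> \<noteq> \<beta> \<and> \<gamma> \<noteq> - \<beta>")
    case False
    then have "?Y \<subseteq> {\<beta>, - \<beta>}" by auto
    then have "card ?Y \<le> card {\<beta>, - \<beta>}"
      by (intro card_mono) auto
    also have "\<dots> \<le> 2"
      by (simp add: card_insert_if)
    finally have "card ?Y \<le> 2" .
    moreover have "1 \<le> dim S"
      using dim_orthogonal_less[OF S(4) \<beta>, of "cr \<beta>"] root_coroot_self[OF \<beta>R] by simp
    ultimately show ?thesis by linarith
  next
    case True
    then obtain \<gamma> where \<gamma>: "\<gamma> \<in> S" "\<gamma> (cr \<beta>) \<noteq> 0" "\<gamma> \<noteq> \<beta>" "\<gamma> \<noteq> - \<beta>" by blast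
    have \<gamma>R: "\<gamma> \<in> R" using \<gamma>(1) S(1) by blast
    have "conorm \<gamma> = 2 * conorm \<beta>"
      using short[OF \<gamma>R] equal_length[OF \<gamma>R] \<gamma> by auto
    then have pairing: "\<beta> (cr \<gamma>) = 2 * \<gamma> (cr \<beta>)"
      using pairing_symmetry[OF \<gamma>R \<beta>R] conorm_pos[OF \<beta>R] by simp
    define \<delta> where "\<delta> = refl \<gamma> \<beta>"
    have \<delta>: "\<delta> \<in> S" "\<delta> \<in> R" "conorm \<delta> = conorm \<beta>" "\<delta> (cr \<beta>) = 0"
      using S(2)[OF \<gamma>(1) \<beta>] S(1) conorm_refl[OF \<gamma>R \<beta>R] unit[OF \<gamma>R \<gamma>(3,4)] \<gamma>(2)
      by (auto simp: \<delta>_def refl_apply pairing root_coroot_self[OF \<beta>R])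
    let ?S' = "{\<gamma> \<in> S. conorm \<gamma> \<noteq> conorm \<beta>}"
    let ?Y' = "{\<gamma> \<in> ?S'. \<gamma> (cr \<beta>) \<noteq> 0}" and ?Z' = "{\<gamma> \<in> ?S'. \<gamma> (cr \<beta>) = 0}"
    have "card ?Y' \<le> card ?Z' + 2 * dim ?S'"
    proof (rule card_nonvanishing_le[OF root_subsystem_conorm[OF assms(1)]])
      fix \<gamma> assume "\<gamma> \<in> ?S'"
      then show "\<gamma> (cr \<beta>) \<in> {-1, 0, 1}"
        using unit S(1) conorm_uminus[OF \<beta>R] by auto
    qed
    moreover have "dim ?S' \<le> dim S"
      using S(4) by (intro dim_mono_finite) auto
    moreover have "card ?Y \<le> card ?Y' + 2"
    proof -
      have "?Y \<subseteq> ?Y' \<union> {\<beta>, - \<beta>}"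
        using equal_length S(1) by auto
      then have "card ?Y \<le> card (?Y' \<union> {\<beta>, - \<beta>})"
        using S(4) by (intro card_mono) auto
      also have "\<dots> \<le> card ?Y' + card {\<beta>, - \<beta>}"
        by (rule card_Un_le)
      finally show ?thesis by (simp add: card_insert_if split: if_splits)
    qed
    moreover have "card ?Z' + 2 \<le> card ?Z"
    proof -
      have sub: "?Z' \<union> {\<delta>, - \<delta>} \<subseteq> ?Z"
        using \<delta> S(3) by auto
      have "card (?Z' \<union> {\<delta>, - \<delta>}) = card ?Z' + card {\<delta>, - \<delta>}"
        using S(4) \<delta>(3) conorm_uminus[OF \<delta>(2)] by (intro card_Un_disjoint) auto
      also have "card {\<delta>, - \<delta>} = 2"
        using root_neq_uminus[OF \<delta>(2)] by simp
      finally have "card ?Z' + 2 = card (?Z' \<union> {\<delta>, - \<delta>})" ..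
      also have "\<dots> \<le> card ?Z"
        by (rule card_mono[OF _ sub]) (use S(4) in simp)
      finally show ?thesis .
    qed
    ultimately show ?thesis by linarith
  qed
qed

end

section \<open>Simple roots\<close>

lemma sum_fun_apply: "(\<Sum>i\<in>A. f i) x = (\<Sum>i\<in>A. f i x)"
  for f :: "'i \<Rightarrow> 'c \<Rightarrow> 'b::comm_monoid_add"
  by (induction A rule: infinite_finite_induct) auto

locale based_system = reduced_system a R
  for a :: "'v::euclidean_space set" and R +
  fixes \<Delta> :: "('v \<Rightarrow> real) set"
  assumes base: "root_base a R \<Delta>"
begin

lemma finite_base: "finite \<Delta>" and base_subset: "\<Delta> \<subseteq> R" and independent_base: "independent \<Delta>"
  and span_base_eq: "span \<Delta> = dual_space a"
  using base by (auto simp: root_base_def)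

lemma base_root: "\<delta> \<in> \<Delta> \<Longrightarrow> \<delta> \<in> R"
  using base_subset by blast

lemma root_cases:
  assumes "\<beta> \<in> R"
  obtains c :: "('v \<Rightarrow> real) \<Rightarrow> nat" where "\<beta> = (\<Sum>\<delta>\<in>\<Delta>. real (c \<delta>) *\<^sub>R \<delta>)"
  | c :: "('v \<Rightarrow> real) \<Rightarrow> nat" where "- \<beta> = (\<Sum>\<delta>\<in>\<Delta>. real (c \<delta>) *\<^sub>R \<delta>)"
proof -
  from base assms obtain c :: "('v \<Rightarrow> real) \<Rightarrow> nat"
    where "\<beta> = (\<Sum>\<delta>\<in>\<Delta>. real (c \<delta>) *\<^sub>R \<delta>) \<or> \<beta> = - (\<Sum>\<delta>\<in>\<Delta>. real (c \<delta>) *\<^sub>R \<delta>)"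
    unfolding root_base_def by blast
  then show ?thesis
  proof
    assume "\<beta> = - (\<Sum>\<delta>\<in>\<Delta>. real (c \<delta>) *\<^sub>R \<delta>)"
    then have "- \<beta> = (\<Sum>\<delta>\<in>\<Delta>. real (c \<delta>) *\<^sub>R \<delta>)" by simp
    then show ?thesis by (rule that(2))
  qed (rule that(1))
qed

lemma coefficients_unique:
  assumes "(\<Sum>\<delta>\<in>\<Delta>. u \<delta> *\<^sub>R \<delta>) = (\<Sum>\<delta>\<in>\<Delta>. v \<delta> *\<^sub>R \<delta>)" "\<delta> \<in> \<Delta>"
  shows "u \<delta> = v \<delta>"
proof -
  have "(\<Sum>\<delta>\<in>\<Delta>. (u \<delta> - v \<delta>) *\<^sub>R \<delta>) = 0"
    using assms(1) by (simp add: scaleR_left_diff_distrib sum_subtractf)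
  then have "u \<delta> - v \<delta> = 0"
    by (intro independentD[OF independent_base finite_base order_refl]) (use assms(2) in auto)
  then show ?thesis by simp
qed

text \<open>Since \<open>\<beta>\<close> has pairing \<open>2\<close> with its own coroot, some simple root \<open>\<delta>\<close> in its support satisfies
  \<open>\<beta> (cr \<delta>) > 0\<close>. The reflection in \<open>\<delta>\<close> changes only the coefficient of \<open>\<delta>\<close> and lowers it; a positive
  root other than \<open>\<delta>\<close> has another nonzero coefficient, so that the new root is still positive.\<close>
lemma positive_root_induct:
  assumes I: "I \<subseteq> \<Delta>"
    and simple: "\<And>\<delta>. \<delta> \<in> I \<Longrightarrow> P \<delta>"
    and step: "\<And>\<beta> \<delta>. \<beta> \<in> R \<Longrightarrow> P \<beta> \<Longrightarrow> \<delta> \<in> I \<Longrightarrow> P (refl \<delta> \<beta>)"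
    and "\<beta> \<in> R" "\<beta> = (\<Sum>\<delta>\<in>\<Delta>. real (c \<delta>) *\<^sub>R \<delta>)" "\<And>\<delta>. \<delta> \<in> \<Delta> - I \<Longrightarrow> c \<delta> = 0"
  shows "P \<beta> \<and> P (- \<beta>)"
  using assms(4-)
proof (induction "sum c \<Delta>" arbitrary: \<beta> c rule: less_induct)
  case less
  note \<beta> = less.prems(1) and exp = less.prems(2) and supp = less.prems(3)
  show ?case
  proof (cases "\<beta> \<in> I")
    case True
    then show ?thesis
      using simple step[of \<beta> \<beta>] \<beta> refl_self[OF \<beta>] by simp
  next
    case False
    have "2 = (\<Sum>\<delta>\<in>\<Delta>. real (c \<delta>) * \<delta> (cr \<beta>))"
      using root_coroot_self[OF \<beta>] arg_cong[OF exp, of "\<lambda>f. f (cr \<beta>)"]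
      by (simp add: sum_fun_apply scaleR_fun_def)
    then have "\<not> (\<forall>\<delta>\<in>\<Delta>. real (c \<delta>) * \<delta> (cr \<beta>) \<le> 0)"
      using sum_nonpos[of \<Delta> "\<lambda>\<delta>. real (c \<delta>) * \<delta> (cr \<beta>)"] by auto
    then obtain \<delta> where \<delta>: "\<delta> \<in> \<Delta>" "real (c \<delta>) * \<delta> (cr \<beta>) > 0"
      by (auto simp: not_le)
    then have pos: "c \<delta> > 0" "\<delta> (cr \<beta>) > 0"
      by (auto simp: zero_less_mult_iff)
    have \<delta>I: "\<delta> \<in> I"
      using supp[of \<delta>] pos(1) \<delta>(1) by auto
    have \<delta>R: "\<delta> \<in> R"
      using base_root[OF \<delta>(1)] .
    define m where "m = \<beta> (cr \<delta>)"
    have "m * conorm \<beta> = \<delta> (cr \<beta>) * conorm \<delta>"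
      using pairing_symmetry[OF \<delta>R \<beta>] by (simp add: m_def)
    then have "m * conorm \<beta> > 0"
      using pos(2) conorm_pos[OF \<delta>R] by simp
    then have m: "m > 0"
      using conorm_pos[OF \<beta>] by (simp add: zero_less_mult_iff)
    define \<beta>' where "\<beta>' = refl \<delta> \<beta>"
    have \<beta>': "\<beta>' \<in> R"
      using refl_mem[OF \<delta>R \<beta>] by (simp add: \<beta>'_def)
    let ?u = "\<lambda>\<epsilon>. real (c \<epsilon>) - (if \<epsilon> = \<delta> then m else 0)"
    have "(\<Sum>\<epsilon>\<in>\<Delta>. ?u \<epsilon> *\<^sub>R \<epsilon>) = \<beta> - (\<Sum>\<epsilon>\<in>\<Delta>. if \<epsilon> = \<delta> then m *\<^sub>R \<delta> else 0)"
      unfolding exp scaleR_left_diff_distrib sum_subtractf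
      by (intro arg_cong2[of _ _ _ _ minus] sum.cong) auto
    then have exp': "\<beta>' = (\<Sum>\<epsilon>\<in>\<Delta>. ?u \<epsilon> *\<^sub>R \<epsilon>)"
      using \<delta>(1) finite_base by (simp add: \<beta>'_def reflection_def m_def)
    from \<beta>' show ?thesis
    proof (cases rule: root_cases)
      case (1 c')
      have c': "real (c' \<epsilon>) = ?u \<epsilon>" if "\<epsilon> \<in> \<Delta>" for \<epsilon>
        by (rule coefficients_unique[of "\<lambda>\<epsilon>. real (c' \<epsilon>)" ?u, OF trans[OF sym[OF 1] exp'] that])
      have "c' \<epsilon> \<le> c \<epsilon>" if "\<epsilon> \<in> \<Delta>" for \<epsilon>
        using c'[OF that] m by (auto split: if_splits)
      moreover have "c' \<delta> < c \<delta>"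
        using c'[OF \<delta>(1)] m by auto
      ultimately have "sum c' \<Delta> < sum c \<Delta>"
        using \<delta>(1) finite_base by (intro sum_strict_mono_ex1) auto
      moreover have "c' \<epsilon> = 0" if "\<epsilon> \<in> \<Delta> - I" for \<epsilon>
        using c'[of \<epsilon>] supp[OF that] that \<delta>I by (cases "\<epsilon> = \<delta>") auto
      ultimately have IH: "P \<beta>' \<and> P (- \<beta>')"
        by (intro less.hyps[OF _ \<beta>' 1])
      have twice: "refl \<delta> \<beta>' = \<beta>"
        unfolding \<beta>'_def by (rule refl_refl[OF \<delta>R])
      have "refl \<delta> (- \<beta>') = - refl \<delta> \<beta>'"
        by (rule ext) (simp add: refl_apply)
      then have "refl \<delta> (- \<beta>') = - \<beta>"
        unfolding twice .
      then show ?thesis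
        using step[OF \<beta>' conjunct1[OF IH] \<delta>I] step[OF uminus_root[OF \<beta>'] conjunct2[OF IH] \<delta>I] twice
        by simp
    next
      case (2 c')
      have eq: "(\<Sum>\<epsilon>\<in>\<Delta>. (- real (c' \<epsilon>)) *\<^sub>R \<epsilon>) = (\<Sum>\<epsilon>\<in>\<Delta>. ?u \<epsilon> *\<^sub>R \<epsilon>)"
        unfolding exp'[symmetric] scaleR_minus_left sum_negf 2[symmetric] by (rule minus_minus)
      have "c \<epsilon> = 0" if "\<epsilon> \<in> \<Delta>" "\<epsilon> \<noteq> \<delta>" for \<epsilon>
        using coefficients_unique[OF eq that(1)] that(2) by simp
      then have "\<beta> = (\<Sum>\<epsilon>\<in>\<Delta>. if \<epsilon> = \<delta> then real (c \<delta>) *\<^sub>R \<delta> else 0)"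
        unfolding exp by (intro sum.cong) auto
      then have "\<beta> = real (c \<delta>) *\<^sub>R \<delta>"
        using \<delta>(1) finite_base by simp
      moreover have "real (c \<delta>) = 1 \<or> real (c \<delta>) = - 1"
        using reduced_root_system \<delta>R \<beta> calculation unfolding reduced_root_system_def by blast
      then have "c \<delta> = 1" by linarith
      ultimately show ?thesis
        using False \<delta>I by simp
    qed
  qed
qed

lemma root_induct:
  assumes \<beta>: "\<beta> \<in> R"
    and simple: "\<And>\<delta>. \<delta> \<in> \<Delta> \<Longrightarrow> P \<delta>"
    and step: "\<And>\<beta> \<delta>. \<beta> \<in> R \<Longrightarrow> P \<beta> \<Longrightarrow> \<delta> \<in> \<Delta> \<Longrightarrow> P (refl \<delta> \<beta>)"
  shows "P \<beta>"
  using \<beta>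
proof (cases rule: root_cases)
  case (1 c)
  then show ?thesis
    using positive_root_induct[of \<Delta> P \<beta> c] simple step \<beta> by auto
next
  case (2 c)
  have "P (- \<beta>) \<and> P (- (- \<beta>))"
    by (rule positive_root_induct[of \<Delta> P "- \<beta>" c, OF order_refl simple step uminus_root[OF \<beta>] 2]) auto
  then show ?thesis
    by (simp only: minus_minus)
qed

lemma fundamental_coweight_Ints:
  assumes "fundamental_coweight a \<Delta> \<alpha> \<omega>" "\<beta> \<in> R"
  shows "\<beta> \<omega> \<in> \<int>"
proof -
  have sum: "(\<Sum>\<delta>\<in>\<Delta>. real (c \<delta>) *\<^sub>R \<delta>) \<omega> \<in> \<int>" for c :: "('v \<Rightarrow> real) \<Rightarrow> nat"
    using assms(1)
    by (auto simp: sum_fun_apply scaleR_fun_def fundamental_coweight_def intro!: Ints_sum Ints_mult)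
  show ?thesis
    using assms(2)
  proof (cases rule: root_cases)
    case (1 c)
    then show ?thesis using sum by metis
  next
    case (2 c)
    then have "(- \<beta>) \<omega> \<in> \<int>" using sum by metis
    then show ?thesis by simp
  qed
qed

text \<open>A root vanishing at \<open>\<omega>\<close> has coefficient \<open>0\<close> at the simple root dual to \<open>\<omega>\<close>; by the descent
  of \<open>positive_root_induct\<close> inside the remaining simple roots it lies in the subsystem that
  they generate.\<close>
lemma generated_by_vanishing_simple_roots:
  assumes \<omega>: "fundamental_coweight a \<Delta> \<alpha> \<omega>"
  shows "generated_subsystem a R (\<Delta> - {\<alpha>}) = {\<beta> \<in> R. \<beta> \<omega> = 0}"
proof
  have "root_subsystem a R {\<beta> \<in> R. \<beta> \<omega> = 0}"
    by (rule root_subsystem_orthogonal) (simp add: root_subsystem_def refl_mem)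
  moreover have "\<Delta> - {\<alpha>} \<subseteq> {\<beta> \<in> R. \<beta> \<omega> = 0}"
    using \<omega> base_subset by (auto simp: fundamental_coweight_def)
  ultimately show "generated_subsystem a R (\<Delta> - {\<alpha>}) \<subseteq> {\<beta> \<in> R. \<beta> \<omega> = 0}"
    unfolding generated_subsystem_def by blast
  show "{\<beta> \<in> R. \<beta> \<omega> = 0} \<subseteq> generated_subsystem a R (\<Delta> - {\<alpha>})"
  proof
    fix \<beta> assume "\<beta> \<in> {\<beta> \<in> R. \<beta> \<omega> = 0}"
    then have \<beta>: "\<beta> \<in> R" "\<beta> \<omega> = 0" by auto
    let ?G = "generated_subsystem a R (\<Delta> - {\<alpha>})"
    have G: "root_subsystem a R ?G"
      using base_subset by (intro root_subsystem_generated) auto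
    have sub: "\<Delta> - {\<alpha>} \<subseteq> ?G"
      by (auto simp: generated_subsystem_def)
    have positive: "\<gamma> \<in> ?G \<and> - \<gamma> \<in> ?G"
      if "\<gamma> \<in> R" "\<gamma> \<omega> = 0" "\<gamma> = (\<Sum>\<delta>\<in>\<Delta>. real (c \<delta>) *\<^sub>R \<delta>)" for \<gamma> c
    proof (rule positive_root_induct[of "\<Delta> - {\<alpha>}" "\<lambda>\<gamma>. \<gamma> \<in> ?G", OF _ _ _ that(1,3)])
      have "0 = (\<Sum>\<delta>\<in>\<Delta>. real (c \<delta>) * \<delta> \<omega>)"
        using arg_cong[OF that(3), of "\<lambda>f. f \<omega>"] that(2) by (simp add: sum_fun_apply scaleR_fun_def)
      also have "\<dots> = (\<Sum>\<delta>\<in>\<Delta>. if \<delta> = \<alpha> then real (c \<alpha>) else 0)"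
        using \<omega> by (intro sum.cong) (auto simp: fundamental_coweight_def)
      finally have "c \<alpha> = 0"
        using \<omega> finite_base by (simp add: fundamental_coweight_def)
      then show "\<And>\<delta>. \<delta> \<in> \<Delta> - (\<Delta> - {\<alpha>}) \<Longrightarrow> c \<delta> = 0"
        by auto
    qed (use sub root_subsystemD(2)[OF G] in auto)
    from \<beta>(1) show "\<beta> \<in> ?G"
    proof (cases rule: root_cases)
      case (1 c)
      then show ?thesis using positive[OF \<beta>] by blast
    next
      case (2 c)
      have "(- \<beta>) \<omega> = 0"
        using \<beta>(2) by simp
      from conjunct2[OF positive[OF uminus_root[OF \<beta>(1)] this 2]] show ?thesis
        by (simp only: minus_minus)
    qed
  qed
qed

end

section \<open>Extremal coweights\<close>

locale extremal_coweight = based_system a R \<Delta>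
  for a :: "'v::euclidean_space set" and R \<Delta> +
  fixes ty :: dynkin_type and \<alpha> :: "nat \<Rightarrow> 'v \<Rightarrow> real" and i :: nat and \<omega> :: 'v
  assumes valid: "valid_type ty"
    and numbering: "bourbaki_numbering a R \<Delta> ty \<alpha>"
    and extremal_node: "i \<in> extremal_nodes ty"
    and coweight: "fundamental_coweight a \<Delta> (\<alpha> i) \<omega>"
begin

abbreviation J :: "nat set" where
  "J \<equiv> {1..type_rank ty}"

lemma simple_image: "\<alpha> ` J = \<Delta>" and inj_numbering: "inj_on \<alpha> J"
  using numbering by (auto simp: bourbaki_numbering_def bij_betw_def)

lemma simple_mem: "j \<in> J \<Longrightarrow> \<alpha> j \<in> \<Delta>" and simple_root: "j \<in> J \<Longrightarrow> \<alpha> j \<in> R"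
  using simple_image base_subset by auto

lemma extremal_node_mem: "i \<in> J"
  using extremal_node valid by (cases ty) auto

lemma coweight_mem: "\<omega> \<in> a"
  using coweight by (simp add: fundamental_coweight_def)

lemma coweight_apply:
  assumes "j \<in> J"
  shows "\<alpha> j \<omega> = (if j = i then 1 else 0)"
proof -
  have "\<alpha> j = \<alpha> i \<longleftrightarrow> j = i"
    using inj_on_eq_iff[OF inj_numbering assms extremal_node_mem] .
  moreover have "\<alpha> j \<omega> = (if \<alpha> j = \<alpha> i then 1 else 0)"
    using coweight simple_mem[OF assms] unfolding fundamental_coweight_def by blast
  ultimately show ?thesis by simp
qed

lemma cartan_integer: "j \<in> J \<Longrightarrow> k \<in> J \<Longrightarrow> \<alpha> j (cr (\<alpha> k)) = of_int (cartan_entry ty j k)"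
  using numbering by (simp add: bourbaki_numbering_def)

lemma conorm_simple_symmetry:
  assumes "j \<in> J" "k \<in> J"
  shows "of_int (cartan_entry ty j k) * conorm (\<alpha> j) = of_int (cartan_entry ty k j) * conorm (\<alpha> k)"
  using pairing_symmetry[OF simple_root simple_root, OF assms] assms by (simp add: cartan_integer)

text \<open>The coefficients \<open>m\<close> form column \<open>i\<close> of the inverse Cartan matrix.\<close>
lemma coweight_expansion:
  assumes m: "\<And>k. k \<in> J \<Longrightarrow> (\<Sum>j\<in>J. m j * of_int (cartan_entry ty k j)) = (if k = i then 1 else 0)"
  shows "\<omega> = (\<Sum>j\<in>J. m j *\<^sub>R cr (\<alpha> j))" and "2 * form \<omega> \<omega> = m i * conorm (\<alpha> i)"
proof -
  have mem: "m j *\<^sub>R cr (\<alpha> j) \<in> a" if "j \<in> J" for j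
    using coroot_mem[OF simple_root[OF that]] by (simp add: subspace_scale[OF subspace_a])
  let ?s = "\<Sum>j\<in>J. m j *\<^sub>R cr (\<alpha> j)"
  have s: "?s \<in> a"
    using mem by (intro subspace_sum[OF subspace_a])
  have ev: "\<gamma> (\<Sum>j\<in>K. m j *\<^sub>R cr (\<alpha> j)) = (\<Sum>j\<in>K. m j * \<gamma> (cr (\<alpha> j)))"
    if "\<gamma> \<in> R" "K \<subseteq> J" "finite K" for \<gamma> K
    using that(3,2)
  proof induction
    case empty
    then show ?case
      using root_linear(2)[OF that(1), of 0 0 0] subspace_0[OF subspace_a] by simp
  next
    case (insert j K)
    have "(\<Sum>j\<in>K. m j *\<^sub>R cr (\<alpha> j)) \<in> a"
      using insert.prems by (intro subspace_sum[OF subspace_a] mem) auto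
    moreover have "cr (\<alpha> j) \<in> a" "m j *\<^sub>R cr (\<alpha> j) \<in> a"
      using insert.prems mem coroot_mem[OF simple_root] by auto
    ultimately show ?case
      using insert that(1) by (simp add: root_linear)
  qed
  have "\<omega> - ?s = 0"
  proof (rule separated_by_spanning_set[OF span_base_eq])
    show "\<omega> - ?s \<in> a"
      using coweight_mem s by (rule subspace_diff[OF subspace_a])
    fix \<beta> assume "\<beta> \<in> \<Delta>"
    then obtain k where k: "k \<in> J" "\<beta> = \<alpha> k"
      using simple_image by blast
    have "\<alpha> k ?s = (\<Sum>j\<in>J. m j * of_int (cartan_entry ty k j))"
      using ev[OF simple_root[OF k(1)], of J] cartan_integer[OF k(1)] by simp
    then show "\<beta> (\<omega> - ?s) = 0"
      using coweight_apply[OF k(1)] m[OF k(1)] s coweight_mem simple_root[OF k(1)]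
      by (simp add: k(2) root_linear)
  qed
  then show \<omega>: "\<omega> = ?s" by simp
  have "2 * form \<omega> \<omega> = 2 * form \<omega> ?s"
    using \<omega> by simp
  also have "\<dots> = 2 * (\<Sum>j\<in>J. form \<omega> (m j *\<^sub>R cr (\<alpha> j)))"
    by (simp only: form_sum_right[OF mem])
  also have "\<dots> = (\<Sum>j\<in>J. m j * (2 * form \<omega> (cr (\<alpha> j))))"
    unfolding sum_distrib_left
    by (intro sum.cong refl)
      (simp add: form_linear_right(2)[OF coroot_mem[OF simple_root] coroot_mem[OF simple_root]] del: atLeastAtMost_iff)
  also have "\<dots> = (\<Sum>j\<in>J. if j = i then m i * conorm (\<alpha> i) else 0)"
    by (rule sum.cong) (auto simp: form_coroot[OF simple_root] coweight_apply)
  also have "\<dots> = m i * conorm (\<alpha> i)"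
    using extremal_node_mem by simp
  finally show "2 * form \<omega> \<omega> = m i * conorm (\<alpha> i)" .
qed

lemma conorm_root_cases:
  assumes "\<beta> \<in> R"
  obtains j where "j \<in> J" "conorm \<beta> = conorm (\<alpha> j)"
proof -
  have "\<exists>j\<in>J. conorm \<beta> = conorm (\<alpha> j)"
    using assms
    by (rule root_induct) (use simple_image base_root in \<open>auto simp: conorm_refl\<close>)
  then show ?thesis using that by blast
qed

text \<open>The hypotheses say that \<open>\<omega>\<close> is shorter than every coroot, so the Cauchy-Schwarz inequality
  bounds the integer \<open>\<beta> \<omega>\<close> strictly by \<open>2\<close>.\<close>
lemma minuscule_values:
  fixes m :: "nat \<Rightarrow> real"
  assumes m: "\<And>k. k \<in> J \<Longrightarrow> (\<Sum>j\<in>J. m j * of_int (cartan_entry ty k j)) = (if k = i then 1 else 0)"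
    and less: "m i < 2" and le: "\<And>j. j \<in> J \<Longrightarrow> conorm (\<alpha> i) \<le> conorm (\<alpha> j)"
    and \<beta>: "\<beta> \<in> R"
  shows "\<beta> \<omega> \<in> {-1, 0, 1}"
proof -
  obtain j where j: "j \<in> J" "conorm \<beta> = conorm (\<alpha> j)"
    using conorm_root_cases[OF \<beta>] .
  have pos: "conorm (\<alpha> i) > 0"
    using conorm_pos[OF simple_root[OF extremal_node_mem]] .
  have "(\<beta> \<omega>)\<^sup>2 * conorm \<beta> \<le> 2 * (m i * conorm (\<alpha> i))"
    using cauchy_schwarz_coroot(1)[OF coweight_mem \<beta>] coweight_expansion(2)[OF m] by simp
  also have "\<dots> < 4 * conorm (\<alpha> i)"
    using less pos by simp
  also have "\<dots> \<le> 4 * conorm \<beta>"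
    using le j by simp
  finally have "(\<beta> \<omega>)\<^sup>2 < 2\<^sup>2"
    using conorm_pos[OF \<beta>] by simp
  then have "\<bar>\<beta> \<omega>\<bar> < 2"
    using power2_less_imp_less[of "\<bar>\<beta> \<omega>\<bar>" 2] by simp
  then show ?thesis
    using Ints_abs_cases[OF fundamental_coweight_Ints[OF coweight \<beta>]] by auto
qed

end

section \<open>The five types\<close>

lemma sum_three_term:
  fixes f :: "nat \<Rightarrow> 'c::comm_monoid_add"
  assumes k: "k \<in> {1..n}" and zero: "\<And>j. j \<in> {1..n} \<Longrightarrow> j + 1 \<noteq> k \<Longrightarrow> j \<noteq> k \<Longrightarrow> j \<noteq> k + 1 \<Longrightarrow> f j = 0"
  shows "(\<Sum>j\<in>{1..n}. f j) =
    (if 1 < k then f (k - 1) else 0) + (f k + (if k < n then f (k + 1) else 0))"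
proof -
  let ?A = "if 1 < k then {k - 1} else {}" and ?B = "if k < n then {k + 1} else {}"
  have "(\<Sum>j\<in>{1..n}. f j) = (\<Sum>j\<in>?A \<union> ({k} \<union> ?B). f j)"
    using k by (intro sum.mono_neutral_right) (auto intro!: zero split: if_splits)
  also have "\<dots> = sum f ?A + (f k + sum f ?B)"
    by (subst sum.union_disjoint, (auto)[3], subst sum.union_disjoint) auto
  finally show ?thesis by simp
qed

lemma chain_constant:
  fixes n :: nat
  assumes "\<And>j. 1 \<le> j \<Longrightarrow> j < n \<Longrightarrow> f j = f (Suc j)" "1 \<le> j" "j \<le> n"
  shows "f j = f 1"
  using assms(2,3)
proof (induction j)
  case (Suc j)
  then show ?case
    using assms(1)[of j] by (cases "j = 0") auto
qed simp

context extremal_coweight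
begin

lemma conorm_eq_of_single_bond:
  assumes "j \<in> J" "k \<in> J" "cartan_entry ty j k = -1" "cartan_entry ty k j = -1"
  shows "conorm (\<alpha> j) = conorm (\<alpha> k)"
  using conorm_simple_symmetry[OF assms(1,2)] assms(3,4) by simp

lemma minuscule_A:
  assumes ty: "ty = A_type n" and \<beta>: "\<beta> \<in> R"
  shows "\<beta> \<omega> \<in> {-1, 0, 1}"
proof -
  have i: "i = 1 \<or> i = n" and n: "n \<ge> 1"
    using extremal_node valid by (auto simp: ty)
  define u :: "nat \<Rightarrow> real" where "u j = (if i = 1 then real (n + 1) - real j else real j)" for j
  define m :: "nat \<Rightarrow> real" where "m j = u j / real (n + 1)" for j
  show ?thesis
  proof (rule minuscule_values[of m, OF _ _ _ \<beta>])
    fix k assume k: "k \<in> J"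
    have "(\<Sum>j\<in>J. m j * of_int (cartan_entry ty k j)) =
      (if 1 < k then - m (k - 1) else 0) + (2 * m k + (if k < n then - m (k + 1) else 0))"
      unfolding ty type_rank.simps
      by (subst sum_three_term[where k = k]) (use k in \<open>auto simp: ty cartan_entry_def\<close>)
    also have "\<dots> =
      ((if 1 < k then - u (k - 1) else 0) + (2 * u k + (if k < n then - u (k + 1) else 0))) / real (n + 1)"
      by (simp add: m_def add_divide_distrib diff_divide_distrib)
    also have "(if 1 < k then - u (k - 1) else 0) + (2 * u k + (if k < n then - u (k + 1) else 0)) =
      (if k = i then real (n + 1) else 0)"
      using k i by (auto simp: u_def ty of_nat_diff)
    also have "\<dots> / real (n + 1) = (if k = i then 1 else 0)"
      by simp
    finally show "(\<Sum>j\<in>J. m j * of_int (cartan_entry ty k j)) = (if k = i then 1 else 0)" .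
  next
    show "m i < 2"
      using i n by (auto simp: m_def u_def field_simps)
    have step: "conorm (\<alpha> j) = conorm (\<alpha> (Suc j))" if "1 \<le> j" "j < n" for j
      using that by (intro conorm_eq_of_single_bond) (auto simp: ty cartan_entry_def)
    have const: "conorm (\<alpha> j) = conorm (\<alpha> 1)" if "j \<in> J" for j
      using chain_constant[of n "\<lambda>j. conorm (\<alpha> j)" j, OF step] that by (simp add: ty)
    show "conorm (\<alpha> i) \<le> conorm (\<alpha> j)" if "j \<in> J" for j
      using const[OF that] const[OF extremal_node_mem] by simp
  qed
qed

lemma minuscule_B:
  assumes ty: "ty = B_type n" and \<beta>: "\<beta> \<in> R"
  shows "\<beta> \<omega> \<in> {-1, 0, 1}"
proof -
  have i: "i = 1" and n: "n \<ge> 2"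
    using extremal_node valid by (auto simp: ty)
  define m :: "nat \<Rightarrow> real" where "m j = (if j = n then 1 / 2 else 1)" for j
  show ?thesis
  proof (rule minuscule_values[of m, OF _ _ _ \<beta>])
    fix k assume k: "k \<in> J"
    have "(\<Sum>j\<in>J. m j * of_int (cartan_entry ty k j)) =
      (if 1 < k then - 1 else 0) + (2 * m k + (if k < n then - 1 else 0))"
      unfolding ty type_rank.simps
      by (subst sum_three_term[where k = k]) (use k in \<open>auto simp: ty cartan_entry_def m_def\<close>)
    also have "\<dots> = (if k = i then 1 else 0)"
      using k n by (auto simp: m_def ty i)
    finally show "(\<Sum>j\<in>J. m j * of_int (cartan_entry ty k j)) = (if k = i then 1 else 0)" .
  next
    show "m i < 2"
      by (simp add: m_def)
    have step: "conorm (\<alpha> j) = conorm (\<alpha> (Suc j))" if "1 \<le> j" "j < n - 1" for j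
      using that by (intro conorm_eq_of_single_bond) (auto simp: ty cartan_entry_def)
    have const: "conorm (\<alpha> j) = conorm (\<alpha> 1)" if "1 \<le> j" "j \<le> n - 1" for j
      using chain_constant[of "n - 1" "\<lambda>j. conorm (\<alpha> j)" j, OF step] that by simp
    have "cartan_entry ty (n - 1) n = -2" "cartan_entry ty n (n - 1) = -1" "n - 1 \<in> J" "n \<in> J"
      using n by (auto simp: ty cartan_entry_def)
    then have last: "conorm (\<alpha> n) = 2 * conorm (\<alpha> (n - 1))"
      using conorm_simple_symmetry[of "n - 1" n] by simp
    show "conorm (\<alpha> i) \<le> conorm (\<alpha> j)" if "j \<in> J" for j
    proof (cases "j = n")
      case True
      then show ?thesis
        using last const[of "n - 1"] n form_nonneg[of "cr (\<alpha> 1)"] by (simp add: i)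
    next
      case False
      then show ?thesis
        using const[of j] that by (auto simp: ty i)
    qed
  qed
qed

lemma minuscule_D:
  assumes ty: "ty = D_type n" and \<beta>: "\<beta> \<in> R"
  shows "\<beta> \<omega> \<in> {-1, 0, 1}"
proof -
  have i: "i = 1" and n: "n \<ge> 4"
    using extremal_node valid by (auto simp: ty)
  define m :: "nat \<Rightarrow> real" where "m j = (if j + 1 \<ge> n then 1 / 2 else 1)" for j
  show ?thesis
  proof (rule minuscule_values[of m, OF _ _ _ \<beta>])
    fix k assume k: "k \<in> J"
    let ?f = "\<lambda>j. m j * of_int (cartan_entry ty k j)"
    \<comment> \<open>The nodes below \<open>n\<close> form a chain, and node \<open>n\<close> is attached to node \<open>n - 2\<close>.\<close>
    have "{1..n} = insert n {1..n - 1}"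
      using n by auto
    then have split: "(\<Sum>j\<in>J. ?f j) = ?f n + (\<Sum>j\<in>{1..n - 1}. ?f j)"
      using n by (simp add: ty)
    show "(\<Sum>j\<in>J. ?f j) = (if k = i then 1 else 0)"
    proof (cases "k = n")
      case True
      have "(\<Sum>j\<in>{1..n - 1}. ?f j) = (\<Sum>j\<in>{n - 2}. ?f j)"
        using n True by (intro sum.mono_neutral_right) (auto simp: ty cartan_entry_def)
      moreover have "?f (n - 2) = - 1" "?f n = 1"
        using n by (auto simp: m_def ty cartan_entry_def True)
      ultimately show ?thesis
        using split n True by (simp add: i)
    next
      case False
      then have k': "k \<in> {1..n - 1}"
        using k by (auto simp: ty)
      have "(\<Sum>j\<in>{1..n - 1}. ?f j) =
        (if 1 < k then - m (k - 1) else 0) + (2 * m k + (if k < n - 1 then - m (k + 1) else 0))"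
        by (subst sum_three_term[OF k']) (use k' in \<open>auto simp: ty cartan_entry_def\<close>)
      moreover have "?f n = (if k + 2 = n then - (1 / 2) else 0)"
        using k' n by (auto simp: m_def ty cartan_entry_def)
      ultimately show ?thesis
        using k' n unfolding split by (auto simp: m_def i)
    qed
  next
    show "m i < 2"
      by (simp add: m_def)
    have step: "conorm (\<alpha> j) = conorm (\<alpha> (Suc j))" if "1 \<le> j" "j < n - 1" for j
      using that by (intro conorm_eq_of_single_bond) (auto simp: ty cartan_entry_def)
    have const: "conorm (\<alpha> j) = conorm (\<alpha> 1)" if "1 \<le> j" "j \<le> n - 1" for j
      using chain_constant[of "n - 1" "\<lambda>j. conorm (\<alpha> j)" j, OF step] that by simp
    have last: "conorm (\<alpha> n) = conorm (\<alpha> (n - 2))"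
      using n by (intro conorm_eq_of_single_bond) (auto simp: ty cartan_entry_def)
    show "conorm (\<alpha> i) \<le> conorm (\<alpha> j)" if "j \<in> J" for j
    proof (cases "j = n")
      case True
      then show ?thesis
        using last const[of "n - 2"] n by (simp add: i)
    next
      case False
      then show ?thesis
        using const[of j] that by (auto simp: ty i)
    qed
  qed
qed

lemma minuscule_E7:
  assumes ty: "ty = E7_type" and \<beta>: "\<beta> \<in> R"
  shows "\<beta> \<omega> \<in> {-1, 0, 1}"
proof -
  have i: "i = 7"
    using extremal_node by (simp add: ty)
  have J: "J = {1, 2, 3, 4, 5, 6, 7}"
    by (auto simp: ty)
  define m :: "nat \<Rightarrow> real" where
    "m = (\<lambda>_. 0)(1 := 1, 2 := 3/2, 3 := 2, 4 := 3, 5 := 5/2, 6 := 2, 7 := 3/2)"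
  show ?thesis
  proof (rule minuscule_values[of m, OF _ _ _ \<beta>])
    show "(\<Sum>j\<in>J. m j * of_int (cartan_entry ty k j)) = (if k = i then 1 else 0)" if "k \<in> J" for k
      using that unfolding J by (auto simp: m_def ty cartan_entry_def i)
    show "m i < 2"
      by (simp add: m_def i)
    have bond: "conorm (\<alpha> j) = conorm (\<alpha> k)" if "dynkin_edge ty j k" for j k
      using that by (intro conorm_eq_of_single_bond) (auto simp: ty cartan_entry_def)
    have "conorm (\<alpha> 1) = conorm (\<alpha> 3)" "conorm (\<alpha> 3) = conorm (\<alpha> 4)" "conorm (\<alpha> 2) = conorm (\<alpha> 4)"
      "conorm (\<alpha> 4) = conorm (\<alpha> 5)" "conorm (\<alpha> 5) = conorm (\<alpha> 6)" "conorm (\<alpha> 6) = conorm (\<alpha> 7)"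
      by (rule bond; simp add: ty)+
    then show "conorm (\<alpha> i) \<le> conorm (\<alpha> j)" if "j \<in> J" for j
      using that unfolding J i by auto
  qed
qed

text \<open>Type \<open>C\<close> is not minuscule. The coweight \<open>\<omega>\<close> is the sum of the simple coroots and is itself as short as a
  coroot of a long root. The property "\<open>\<beta>\<close> takes even values at all simple coroots" holds for the
  long simple root and is preserved by simple reflections, hence holds for all long roots.\<close>
lemma C_structure:
  assumes ty: "ty = C_type n"
  shows "form \<omega> \<omega> = conorm (\<alpha> n)"
    and "\<beta> \<in> R \<Longrightarrow> conorm \<beta> = 2 * conorm (\<alpha> n) \<or> conorm \<beta> = conorm (\<alpha> n) \<and> \<beta> \<omega> / 2 \<in> \<int>"
proof -
  have i: "i = 1" and n: "n \<ge> 3"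
    using extremal_node valid by (auto simp: ty)
  have step: "conorm (\<alpha> j) = conorm (\<alpha> (Suc j))" if "1 \<le> j" "j < n - 1" for j
    using that by (intro conorm_eq_of_single_bond) (auto simp: ty cartan_entry_def)
  have const: "conorm (\<alpha> j) = conorm (\<alpha> 1)" if "1 \<le> j" "j \<le> n - 1" for j
    using chain_constant[of "n - 1" "\<lambda>j. conorm (\<alpha> j)" j, OF step] that by simp
  have "cartan_entry ty (n - 1) n = -1" "cartan_entry ty n (n - 1) = -2" "n - 1 \<in> J" "n \<in> J"
    using n by (auto simp: ty cartan_entry_def)
  then have "conorm (\<alpha> (n - 1)) = 2 * conorm (\<alpha> n)"
    using conorm_simple_symmetry[of "n - 1" n] by simp
  then have short: "conorm (\<alpha> j) = 2 * conorm (\<alpha> n)" if "1 \<le> j" "j \<le> n - 1" for j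
    using const[OF that] const[of "n - 1"] n by simp
  have row: "(\<Sum>j\<in>J. 1 * of_int (cartan_entry ty k j)) = (if k = i then 1 else (0 :: real))"
    if k: "k \<in> J" for k
  proof -
    have "(\<Sum>j\<in>J. 1 * of_int (cartan_entry ty k j)) =
      (if 1 < k then if k = n then - 2 else - 1 else 0) + (2 + (if k < n then - 1 else (0 :: real)))"
      unfolding ty type_rank.simps
      by (subst sum_three_term[where k = k]) (use k in \<open>auto simp: ty cartan_entry_def\<close>)
    also have "\<dots> = (if k = i then 1 else 0)"
      using k n by (auto simp: ty i)
    finally show ?thesis .
  qed
  show "form \<omega> \<omega> = conorm (\<alpha> n)"
    using coweight_expansion(2)[of "\<lambda>_. 1", OF row] short[of 1] n by (simp add: i)
  have \<omega>: "\<omega> = (\<Sum>j\<in>J. cr (\<alpha> j))"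
    using coweight_expansion(1)[of "\<lambda>_. 1", OF row] by simp
  let ?even = "\<lambda>\<beta>. \<forall>j\<in>J. \<beta> (cr (\<alpha> j)) / 2 \<in> \<int>"
  show "conorm \<beta> = 2 * conorm (\<alpha> n) \<or> conorm \<beta> = conorm (\<alpha> n) \<and> \<beta> \<omega> / 2 \<in> \<int>" if \<beta>: "\<beta> \<in> R"
  proof -
    have "conorm \<beta> = 2 * conorm (\<alpha> n) \<or> conorm \<beta> = conorm (\<alpha> n) \<and> ?even \<beta>"
      using \<beta>
    proof (rule root_induct)
      fix \<delta> assume "\<delta> \<in> \<Delta>"
      then obtain k where k: "k \<in> J" "\<delta> = \<alpha> k"
        using simple_image by blast
      show "conorm \<delta> = 2 * conorm (\<alpha> n) \<or> conorm \<delta> = conorm (\<alpha> n) \<and> ?even \<delta>"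
      proof (cases "k = n")
        case True
        have "\<alpha> n (cr (\<alpha> j)) / 2 \<in> \<int>" if "j \<in> J" for j
          using cartan_integer[of n j] that n by (auto simp: ty cartan_entry_def)
        then show ?thesis using k True by blast
      next
        case False
        then have "1 \<le> k" "k \<le> n - 1"
          using k(1) by (auto simp: ty)
        then show ?thesis
          using short[of k] by (simp add: k(2))
      qed
    next
      fix \<beta> \<delta>
      assume \<beta>: "\<beta> \<in> R" and \<delta>: "\<delta> \<in> \<Delta>"
        and IH: "conorm \<beta> = 2 * conorm (\<alpha> n) \<or> conorm \<beta> = conorm (\<alpha> n) \<and> ?even \<beta>"
      obtain k where k: "k \<in> J" "\<delta> = \<alpha> k"
        using \<delta> simple_image by blast
      have "?even (refl \<delta> \<beta>)" if "?even \<beta>"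
      proof
        fix j assume j: "j \<in> J"
        have "refl \<delta> \<beta> (cr (\<alpha> j)) / 2 =
          \<beta> (cr (\<alpha> j)) / 2 - \<beta> (cr (\<alpha> k)) / 2 * of_int (cartan_entry ty k j)"
          by (simp add: refl_apply k(2) cartan_integer[OF k(1) j] diff_divide_distrib)
        also have "\<dots> \<in> \<int>"
          using that j k(1) by (intro Ints_diff Ints_mult) auto
        finally show "refl \<delta> \<beta> (cr (\<alpha> j)) / 2 \<in> \<int>" .
      qed
      then show "conorm (refl \<delta> \<beta>) = 2 * conorm (\<alpha> n) \<or>
          conorm (refl \<delta> \<beta>) = conorm (\<alpha> n) \<and> ?even (refl \<delta> \<beta>)"
        using IH conorm_refl[OF base_root[OF \<delta>] \<beta>] by metis
    qed
    moreover have "\<beta> \<omega> / 2 \<in> \<int>" if "?even \<beta>"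
    proof -
      have "form \<omega> (cr \<beta>) = (\<Sum>j\<in>J. form (cr \<beta>) (cr (\<alpha> j)))"
        unfolding form_commute[of \<omega> "cr \<beta>"] unfolding \<omega>
        by (rule form_sum_right) (rule coroot_mem[OF simple_root])
      then have "2 * form \<omega> (cr \<beta>) = (\<Sum>j\<in>J. 2 * form (cr \<beta>) (cr (\<alpha> j)))"
        by (simp only: sum_distrib_left)
      also have "\<dots> = (\<Sum>j\<in>J. \<beta> (cr (\<alpha> j))) * conorm \<beta>"
        unfolding sum_distrib_right
        by (rule sum.cong[OF HOL.refl]) (subst form_commute, rule form_coroot[OF \<beta>])
      finally have "\<beta> \<omega> = (\<Sum>j\<in>J. \<beta> (cr (\<alpha> j)))"
        using form_coroot[OF \<beta>, of \<omega>] conorm_pos[OF \<beta>] by simp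
      then have "\<beta> \<omega> / 2 = (\<Sum>j\<in>J. \<beta> (cr (\<alpha> j)) / 2)"
        by (simp add: sum_divide_distrib)
      then show ?thesis
        using that by (auto intro: Ints_sum)
    qed
    ultimately show ?thesis by blast
  qed
qed

text \<open>A value \<open>\<plusminus> 2\<close> is the case of equality in the Cauchy-Schwarz inequality.\<close>
lemma C_large_value:
  assumes ty: "ty = C_type n" and \<gamma>: "\<gamma> \<in> R" and large: "\<bar>\<gamma> \<omega>\<bar> \<ge> 2"
  shows "conorm \<gamma> = conorm (\<alpha> n)" and "\<omega> = cr \<gamma> \<or> \<omega> = cr (- \<gamma>)"
proof -
  have sq: "(\<gamma> \<omega>)\<^sup>2 \<ge> 4"
    using power_mono[OF large, of 2] by simp
  have le: "(\<gamma> \<omega>)\<^sup>2 * conorm \<gamma> \<le> 4 * conorm (\<alpha> n)"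
    using cauchy_schwarz_coroot(1)[OF coweight_mem \<gamma>] C_structure(1)[OF ty] by simp
  have ge: "4 * conorm \<gamma> \<le> (\<gamma> \<omega>)\<^sup>2 * conorm \<gamma>"
    using sq conorm_pos[OF \<gamma>] by (intro mult_right_mono) auto
  show eq: "conorm \<gamma> = conorm (\<alpha> n)"
    using C_structure(2)[OF ty \<gamma>] conorm_pos[OF \<gamma>] le ge by linarith
  then have "(\<gamma> \<omega>)\<^sup>2 * conorm \<gamma> = 4 * conorm \<gamma>"
    using le ge by simp
  then have "(\<gamma> \<omega>)\<^sup>2 = 2\<^sup>2"
    using conorm_pos[OF \<gamma>] by simp
  then have two: "\<gamma> \<omega> = 2 \<or> \<gamma> \<omega> = -2"
    unfolding power2_eq_iff .
  have "\<omega> = (\<gamma> \<omega> / 2) *\<^sub>R cr \<gamma>"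
    using cauchy_schwarz_coroot(2)[OF coweight_mem \<gamma>] C_structure(1)[OF ty] eq
      \<open>(\<gamma> \<omega>)\<^sup>2 * conorm \<gamma> = 4 * conorm \<gamma>\<close> by simp
  moreover have "(\<gamma> \<omega> / 2) *\<^sub>R cr \<gamma> = cr \<gamma> \<or> (\<gamma> \<omega> / 2) *\<^sub>R cr \<gamma> = cr (- \<gamma>)"
    using two by (auto simp: coroot_uminus[OF \<gamma>])
  ultimately show "\<omega> = cr \<gamma> \<or> \<omega> = cr (- \<gamma>)"
    by metis
qed

lemma card_nonvanishing_le_C:
  assumes ty: "ty = C_type n" and S: "root_subsystem a R S"
  shows "card {\<gamma> \<in> S. \<gamma> \<omega> \<noteq> 0} \<le> card {\<gamma> \<in> S. \<gamma> \<omega> = 0} + 2 * dim S"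
proof (cases "\<exists>\<gamma>\<in>S. \<bar>\<gamma> \<omega>\<bar> \<ge> 2")
  case False
  show ?thesis
  proof (rule card_nonvanishing_le[OF S])
    fix \<gamma> assume "\<gamma> \<in> S"
    then have "\<gamma> \<in> R" "\<bar>\<gamma> \<omega>\<bar> < 2"
      using root_subsystemD(1)[OF S] False by (auto simp: not_le)
    then show "\<gamma> \<omega> \<in> {-1, 0, 1}"
      using Ints_abs_cases[OF fundamental_coweight_Ints[OF coweight]] by fastforce
  qed
next
  case True
  then obtain \<gamma> where \<gamma>: "\<gamma> \<in> S" "\<gamma> \<in> R" "\<bar>\<gamma> \<omega>\<bar> \<ge> 2"
    using root_subsystemD(1)[OF S] by blast
  have "\<exists>\<beta>\<in>S. \<omega> = cr \<beta> \<and> conorm \<beta> = conorm (\<alpha> n)"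
    using C_large_value[OF ty \<gamma>(2,3)] conorm_uminus[OF \<gamma>(2)] \<gamma>(1) root_subsystemD(3)[OF S \<gamma>(1)]
    by metis
  then obtain \<beta> where \<beta>: "\<beta> \<in> S" "\<beta> \<in> R" "\<omega> = cr \<beta>" "conorm \<beta> = conorm (\<alpha> n)"
    using root_subsystemD(1)[OF S] by blast
  show ?thesis
    unfolding \<beta>(3)
  proof (rule card_nonvanishing_le_long[OF S \<beta>(1)])
    fix \<gamma> assume \<gamma>: "\<gamma> \<in> R"
    show "\<bar>\<gamma> (cr \<beta>)\<bar> < 2 \<or> \<gamma> = \<beta> \<or> \<gamma> = - \<beta>"
    proof (rule disjCI)
      assume "\<not> (\<gamma> = \<beta> \<or> \<gamma> = - \<beta>)"
      then have ne: "\<beta> \<noteq> \<gamma>" "\<beta> \<noteq> - \<gamma>" by auto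
      then have "\<not> \<bar>\<gamma> \<omega>\<bar> \<ge> 2"
        using C_large_value(2)[OF ty \<gamma>] root_eq_of_coroot_eq[OF \<beta>(2) \<gamma>]
          root_eq_of_coroot_eq[OF \<beta>(2) uminus_root[OF \<gamma>]] \<beta>(3) by metis
      then show "\<bar>\<gamma> (cr \<beta>)\<bar> < 2"
        by (simp add: \<beta>(3))
    qed
    show "\<gamma> (cr \<beta>) / 2 \<in> \<int>" if "conorm \<gamma> = conorm \<beta>"
      using C_structure(2)[OF ty \<gamma>] that conorm_pos[OF \<beta>(2)] \<beta>(3,4) by auto
    show "conorm \<gamma> = 2 * conorm \<beta>" if "conorm \<gamma> \<noteq> conorm \<beta>"
      using C_structure(2)[OF ty \<gamma>] that \<beta>(4) by auto
  qed
qed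

lemma card_nonvanishing_le_extremal:
  assumes S: "root_subsystem a R S"
  shows "card {\<gamma> \<in> S. \<gamma> \<omega> \<noteq> 0} \<le> card {\<gamma> \<in> S. \<gamma> \<omega> = 0} + 2 * dim S"
proof (cases "\<exists>n. ty = C_type n")
  case True
  then show ?thesis using card_nonvanishing_le_C S by blast
next
  case False
  show ?thesis
  proof (rule card_nonvanishing_le[OF S])
    fix \<gamma> assume "\<gamma> \<in> S"
    then have "\<gamma> \<in> R"
      using root_subsystemD(1)[OF S] by blast
    then show "\<gamma> \<omega> \<in> {-1, 0, 1}"
      using False minuscule_A minuscule_B minuscule_D minuscule_E7 by (cases ty) blast+
  qed
qed

lemma semi_dense_vanishing: "semi_dense a R \<Delta> {\<beta> \<in> R. \<beta> \<omega> = 0}"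
  unfolding semi_dense_def
proof (intro conjI allI impI)
  have "{\<beta> \<in> R. \<beta> \<omega> = 0} = id ` generated_subsystem a R (\<Delta> - {\<alpha> i})"
    using generated_by_vanishing_simple_roots[OF coweight] by simp
  then show "semistandard a R \<Delta> {\<beta> \<in> R. \<beta> \<omega> = 0}"
    unfolding semistandard_def using weyl_group.weyl_id by blast
next
  fix \<Psi> assume "semistandard a R \<Delta> \<Psi>"
  then have \<Psi>: "root_subsystem a R \<Psi>"
    by (rule root_subsystem_semistandard[OF base_subset])
  let ?Y = "{\<gamma> \<in> \<Psi>. \<gamma> \<omega> \<noteq> 0}" and ?Z = "{\<gamma> \<in> \<Psi>. \<gamma> \<omega> = 0}"
  have "\<Psi> \<inter> {\<beta> \<in> R. \<beta> \<omega> = 0} = ?Z"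
    using root_subsystemD(1)[OF \<Psi>] by blast
  moreover have "card \<Psi> = card ?Y + card ?Z"
  proof -
    have "card (?Y \<union> ?Z) = card ?Y + card ?Z"
      using root_subsystemD(4)[OF \<Psi>] by (intro card_Un_disjoint) auto
    moreover have "?Y \<union> ?Z = \<Psi>" by blast
    ultimately show ?thesis by simp
  qed
  moreover have "card ?Y \<le> card ?Z + 2 * dim \<Psi>"
    by (rule card_nonvanishing_le_extremal[OF \<Psi>])
  ultimately show "real (card (\<Psi> \<inter> {\<beta> \<in> R. \<beta> \<omega> = 0})) + real (root_rank \<Psi>) \<ge> 1 / 2 * real (card \<Psi>)"
    unfolding root_rank_def by simp
qed

end

section \<open>The centralizer of an extremal element\<close>

theorem theorem2p2:
  fixes G :: "('g, 'x) monoid_scheme"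
    and T :: "'g topology"
    and \<A> :: "('g set \<times> ('g \<Rightarrow> 'v::euclidean_space)) set"
    and U :: "'g set" and \<phi> :: "'g \<Rightarrow> 'v"
    and p k a :: "'v set"
    and \<Phi> \<Delta> \<Phi>red \<Phi>M \<Phi>Mred :: "('v \<Rightarrow> real) set"
    and H0 :: 'v
    and M :: "'g set"
  assumes lie_group: "lie_group G T \<A>"
    and connected: "connected_space T"
    and noncompact: "\<not> compact_space T"
    and finite_center: "finite (group_center G)"
    and chart: "(U, \<phi>) \<in> \<A>" "\<one>\<^bsub>G\<^esub> \<in> U"
    and simple: "simple_lie_algebra (lie_bracket G U \<phi>)"
    and cartan: "cartan_decomposition (lie_bracket G U \<phi>) p k"
    and maximal: "maximal_abelian_in (lie_bracket G U \<phi>) p a"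
    and Phi: "\<Phi> = restricted_roots (lie_bracket G U \<phi>) a"
    and Delta: "root_base a \<Phi> \<Delta>"
    and Phi_red: "\<Phi>red = reduced_roots \<Phi>"
    and type_ABCDE7: "\<exists>ty. root_system_of_type a \<Phi>red \<Delta> ty"
    and H0: "extremal a \<Phi>red \<Delta> H0"
    and M: "M = Ad_centralizer G U \<phi> H0"
    and Phi_M: "\<Phi>M = roots_vanishing_at \<Phi> H0"
    and Phi_M_red: "\<Phi>Mred = \<Phi>M \<inter> \<Phi>red"
  shows "semi_dense a \<Phi>red \<Delta> \<Phi>Mred"
proof -
  have "subspace a"
    using maximal by (simp add: maximal_abelian_in_def abelian_subspace_def)
  moreover obtain ty \<alpha> i c \<omega> where ext: "root_system_of_type a \<Phi>red \<Delta> ty"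
      "bourbaki_numbering a \<Phi>red \<Delta> ty \<alpha>" "i \<in> extremal_nodes ty"
      "fundamental_coweight a \<Delta> (\<alpha> i) \<omega>"
    and c: "c > 0" "H0 = c *\<^sub>R \<omega>"
    using H0 unfolding extremal_def by blast
  ultimately interpret extremal_coweight a \<Phi>red \<Delta> ty \<alpha> i \<omega>
    by unfold_locales (auto simp: root_system_of_type_def)
  have "\<beta> H0 = 0 \<longleftrightarrow> \<beta> \<omega> = 0" if "\<beta> \<in> \<Phi>red" for \<beta>
    using root_linear(2)[OF that coweight_mem coweight_mem, of c] c by simp
  then have "\<Phi>Mred = {\<beta> \<in> \<Phi>red. \<beta> \<omega> = 0}"
    unfolding Phi_M_red Phi_M roots_vanishing_at_def Phi_red reduced_roots_def by blast
  then show ?thesis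
    using semi_dense_vanishing by simp
qed

end
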